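(* Let $\mathcal{C}=\mathcal{F}\bowtie\mathcal{G}$ be an indirect product which is a right-Ore category and in which $\mathcal{G}$ is a groupoid, and let $\varepsilon$ be an object of $\mathcal{C}$. \begin{enumerate} \item If the group $\Pi(\mathcal{F},\varepsilon)$ is left-orderable and $\mathcal{G}$ has a $\Phi$-discrete left-ordering (for some functor $\Phi$ to a discrete groupoid as in the context) that is compatible with $\mathcal{F}$, then the group $\Pi(\mathcal{F}\bowtie\mathcal{G},\varepsilon)$ is left-orderable. \item If $\mathcal{F}\bowtie\mathcal{G}$ is pure, $\Pi(\mathcal{F},\varepsilon)$ is bi-orderable and $\mathcal{G}$ has a $\Phi$-discrete bi-ordering that is compatible with $\mathcal{F}$, then $\Pi(\mathcal{F}\bowtie\mathcal{G},\varepsilon)$ is bi-orderable. \end{enumerate}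
   Context: Orders: a group is left-orderable if it admits a (strict) linear order invariant under left multiplication (a left-ordering), and bi-orderable if it admits a linear order invariant under both left and right multiplication (a bi-ordering). Category conventions: $\mathcal{C}(x,y)$ denotes the set of morphisms from $y$ to $x$; if $a\in\mathcal{C}(x,y)$ and $b\in\mathcal{C}(y,z)$ then $ab\in\mathcal{C}(x,z)$. A dash, as in $\mathcal{C}(x,-)$ or $\mathcal{C}(-,x)$, means that the object in that position is arbitrary. A category $\mathcal{C}$ is right-Ore if it is cancellative ($ab=ac\Rightarrow b=c$ and $ab=cb\Rightarrow a=c$) and has common right multiples (for all $a_1,a_2\in\mathcal{C}(x,-)$ there are morphisms $b_1,b_2$ of $\mathcal{C}$ with $a_1b_1=a_2b_2$). The fundamental group $\Pi(\mathcal{C},\varepsilon)$ is the automorphism group of $\varepsilon$ in the groupoid obtained from $\mathcal{C}$ by formally inverting all morphisms. Indirect product: $\mathcal{C}$ is an indirect product $\mathcal{F}\bowtie\mathcal{G}$ of subcategories $\mathcal{F},\mathcal{G}$ (with the same objects as $\mathcal{C}$) if every morphism of $\mathcal{C}$ can be written in a unique way as $fg$ with $f$ in $\mathcal{F}$ and $g$ in $\mathcal{G}$. In particular, for $f\in\mathcal{F}(x,-)$ and $g\in\mathcal{G}(-,x)$ there are unique $f'\in\mathcal{F}$, $g'\in\mathcal{G}$ with $gf=f'g'$; write $g\cdot f:=f'$ and $g^f:=g'$. A groupoid $\mathcal{D}$ is discrete if $\mathcal{D}(x,y)=\emptyset$ whenever $x\neq y$. For a groupoid $\mathcal{G}$,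 $\mathrm{C}\mathcal{G}(x)$ denotes the connected component of $\mathcal{G}$ containing the object $x$ (a full subgroupoid). $\Phi$-discrete ordering: let $\mathcal{D}$ be a discrete groupoid, let $\prec_k$ be a left-ordering on the group $\mathcal{D}(k,k)$ for each object $k$ of $\mathcal{D}$, and let $\Phi:\mathcal{G}\to\mathcal{D}$ be a functor of groupoids such that $\mathcal{G}(x,y)\ne\emptyset$ implies $\Phi(x)=\Phi(y)$. A $\Phi$-discrete left-ordering of $\mathcal{G}$ is the collection of sets $$P_{\mathrm{C}\mathcal{G}(x)}=\{g\in\mathrm{C}\mathcal{G}(x)\mid 1_{\mathcal{D}(\Phi(x),\Phi(x))}\prec_{\Phi(x)}\Phi(g)\}.$$ If the $\prec_k$ are bi-orderings, the collection is called a $\Phi$-discrete bi-ordering. Compatibility: a $\Phi$-discrete ordering on $\mathcal{G}$ is compatible with $\mathcal{F}$ if for all objects $x,y$, all $f\in\mathcal{F}(x,y)$ and all $g\in\mathcal{G}(-,x)$, $g\in P_{\mathrm{C}\mathcal{G}(x)}$ implies $g^f\in P_{\mathrm{C}\mathcal{G}(y)}$. Purity: $\mathcal{F}\bowtie\mathcal{G}$ is pure if $\mathcal{G}$ is a discrete groupoid and $g\cdot f=f$ for all $g\in\mathcal{G}(x,x)$ and $f\in\mathcal{F}(x,-)$.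
   Formalization: A Φ-discrete ordering is also required to be a genuine ordering of G: each non-identity g in a component CG(x) has g or its inverse in P_{CG(x)}. Without this the claim fails, e.g. one object, F trivial, C = G = Z/2, D trivial. *)

theory Defs
  imports "HOL-Algebra.Group"
begin

section \<open>Small categories and groupoids\<close>

text \<open>
  A morphism \<open>a\<close> in \<open>Hom C x y\<close> goes from \<open>y\<close> (its \<open>src\<close>) to \<open>x\<close> (its \<open>tgt\<close>), so that
  \<open>a \<in> Hom C x y\<close> and \<open>b \<in> Hom C y z\<close> give \<open>mul C a b \<in> Hom C x z\<close>.
\<close>

record ('o, 'm) category =
  Obj :: "'o set"
  Arr :: "'m set"
  tgt :: "'m \<Rightarrow> 'o"
  src :: "'m \<Rightarrow> 'o"
  mul :: "'m \<Rightarrow> 'm \<Rightarrow> 'm"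
  ident :: "'o \<Rightarrow> 'm"

definition Hom :: "('o, 'm, 'z) category_scheme \<Rightarrow> 'o \<Rightarrow> 'o \<Rightarrow> 'm set" where
  "Hom C x y = {a \<in> Arr C. tgt C a = x \<and> src C a = y}"

locale category =
  fixes C :: "('o, 'm, 'z) category_scheme"
  assumes tgt_in_Obj: "a \<in> Arr C \<Longrightarrow> tgt C a \<in> Obj C"
    and src_in_Obj: "a \<in> Arr C \<Longrightarrow> src C a \<in> Obj C"
    and ident_in_Hom: "x \<in> Obj C \<Longrightarrow> ident C x \<in> Hom C x x"
    and mul_in_Hom: "a \<in> Hom C x y \<Longrightarrow> b \<in> Hom C y z \<Longrightarrow> mul C a b \<in> Hom C x z"
    and mul_ident_left: "a \<in> Hom C x y \<Longrightarrow> mul C (ident C x) a = a"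
    and mul_ident_right: "a \<in> Hom C x y \<Longrightarrow> mul C a (ident C y) = a"
    and mul_assoc: "a \<in> Hom C w x \<Longrightarrow> b \<in> Hom C x y \<Longrightarrow> c \<in> Hom C y z \<Longrightarrow>
      mul C (mul C a b) c = mul C a (mul C b c)"

definition inverse_pair :: "('o, 'm, 'z) category_scheme \<Rightarrow> 'm \<Rightarrow> 'm \<Rightarrow> bool" where
  "inverse_pair C a b \<longleftrightarrow> a \<in> Arr C \<and> b \<in> Hom C (src C a) (tgt C a) \<and>
     mul C a b = ident C (tgt C a) \<and> mul C b a = ident C (src C a)"

locale groupoid = category +
  assumes invertible: "a \<in> Arr C \<Longrightarrow> \<exists>b. inverse_pair C a b"

definition arr_inv :: "('o, 'm, 'z) category_scheme \<Rightarrow> 'm \<Rightarrow> 'm" where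
  "arr_inv C a = (THE b. inverse_pair C a b)"

definition discrete_groupoid :: "('o, 'm, 'z) category_scheme \<Rightarrow> bool" where
  "discrete_groupoid D \<longleftrightarrow> groupoid D \<and>
     (\<forall>x\<in>Obj D. \<forall>y\<in>Obj D. x \<noteq> y \<longrightarrow> Hom D x y = {})"

definition vertex_group :: "('o, 'm, 'z) category_scheme \<Rightarrow> 'o \<Rightarrow> 'm monoid" where
  "vertex_group C x = \<lparr>carrier = Hom C x x, mult = mul C, one = ident C x\<rparr>"

definition component :: "('o, 'm) category \<Rightarrow> 'o \<Rightarrow> ('o, 'm) category" where
  "component G x = (let K = {y \<in> Obj G. Hom G x y \<noteq> {}}
     in G\<lparr>Obj := K, Arr := {g \<in> Arr G. tgt G g \<in> K \<and> src G g \<in> K}\<rparr>)"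

definition is_functor ::
  "('o, 'm, 'z) category_scheme \<Rightarrow> ('p, 'n, 'w) category_scheme \<Rightarrow> ('o \<Rightarrow> 'p) \<Rightarrow> ('m \<Rightarrow> 'n) \<Rightarrow> bool"
  where
  "is_functor C D \<phi> \<Phi> \<longleftrightarrow> category C \<and> category D \<and>
     (\<forall>x\<in>Obj C. \<phi> x \<in> Obj D) \<and>
     (\<forall>x\<in>Obj C. \<forall>y\<in>Obj C. \<forall>a\<in>Hom C x y. \<Phi> a \<in> Hom D (\<phi> x) (\<phi> y)) \<and>
     (\<forall>x\<in>Obj C. \<Phi> (ident C x) = ident D (\<phi> x)) \<and>
     (\<forall>a\<in>Arr C. \<forall>b\<in>Arr C. src C a = tgt C b \<longrightarrow> \<Phi> (mul C a b) = mul D (\<Phi> a) (\<Phi> b))"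

definition cancellative :: "('o, 'm, 'z) category_scheme \<Rightarrow> bool" where
  "cancellative C \<longleftrightarrow>
     (\<forall>a\<in>Arr C. \<forall>b\<in>Arr C. \<forall>c\<in>Arr C. src C a = tgt C b \<and> src C a = tgt C c \<and>
        mul C a b = mul C a c \<longrightarrow> b = c) \<and>
     (\<forall>a\<in>Arr C. \<forall>b\<in>Arr C. \<forall>c\<in>Arr C. src C a = tgt C b \<and> src C c = tgt C b \<and>
        mul C a b = mul C c b \<longrightarrow> a = c)"

definition right_ore :: "('o, 'm, 'z) category_scheme \<Rightarrow> bool" where
  "right_ore C \<longleftrightarrow> category C \<and> cancellative C \<and>
     (\<forall>a1\<in>Arr C. \<forall>a2\<in>Arr C. tgt C a1 = tgt C a2 \<longrightarrow>
        (\<exists>b1\<in>Arr C. \<exists>b2\<in>Arr C. src C a1 = tgt C b1 \<and> src C a2 = tgt C b2 \<and>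
           mul C a1 b1 = mul C a2 b2))"


section \<open>Formally inverting all morphisms\<close>

text \<open>
  The enveloping groupoid of \<open>C\<close> has the objects of \<open>C\<close>; its morphisms are the zigzags of
  morphisms of \<open>C\<close> modulo the congruence generated by the relations of \<open>C\<close> and by cancellation of
  a morphism against its formal inverse. The end points are stored with the class, since the
  empty zigzag does not determine them.
\<close>

datatype 'm letter = Fwd 'm | Bwd 'm

inductive zigzag :: "('o, 'm) category \<Rightarrow> 'o \<Rightarrow> 'm letter list \<Rightarrow> 'o \<Rightarrow> bool" for C where
  zigzag_Nil: "x \<in> Obj C \<Longrightarrow> zigzag C x [] x"
| zigzag_Fwd: "a \<in> Hom C x y \<Longrightarrow> zigzag C y w z \<Longrightarrow> zigzag C x (Fwd a # w) z"
| zigzag_Bwd: "a \<in> Hom C y x \<Longrightarrow> zigzag C y w z \<Longrightarrow> zigzag C x (Bwd a # w) z"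

inductive zz_relator ::
  "('o, 'm) category \<Rightarrow> 'o \<Rightarrow> 'o \<Rightarrow> 'm letter list \<Rightarrow> 'm letter list \<Rightarrow> bool" for C where
  rel_mul: "a \<in> Hom C x y \<Longrightarrow> b \<in> Hom C y z \<Longrightarrow> zz_relator C x z [Fwd a, Fwd b] [Fwd (mul C a b)]"
| rel_ident: "x \<in> Obj C \<Longrightarrow> zz_relator C x x [Fwd (ident C x)] []"
| rel_Fwd_Bwd: "a \<in> Hom C x y \<Longrightarrow> zz_relator C x x [Fwd a, Bwd a] []"
| rel_Bwd_Fwd: "a \<in> Hom C x y \<Longrightarrow> zz_relator C y y [Bwd a, Fwd a] []"

inductive zz_eq ::
  "('o, 'm) category \<Rightarrow> 'o \<Rightarrow> 'o \<Rightarrow> 'm letter list \<Rightarrow> 'm letter list \<Rightarrow> bool" for C where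
  zz_refl: "zigzag C x w y \<Longrightarrow> zz_eq C x y w w"
| zz_sym: "zz_eq C x y v w \<Longrightarrow> zz_eq C x y w v"
| zz_trans: "zz_eq C x y u v \<Longrightarrow> zz_eq C x y v w \<Longrightarrow> zz_eq C x y u w"
| zz_step: "zigzag C x u y \<Longrightarrow> zz_relator C y z r s \<Longrightarrow> zigzag C z v t \<Longrightarrow>
    zz_eq C x t (u @ r @ v) (u @ s @ v)"

definition zz_class :: "('o, 'm) category \<Rightarrow> 'o \<Rightarrow> 'o \<Rightarrow> 'm letter list \<Rightarrow> 'm letter list set" where
  "zz_class C x y w = {v. zz_eq C x y w v}"

definition enveloping_groupoid ::
  "('o, 'm) category \<Rightarrow> ('o, 'o \<times> 'm letter list set \<times> 'o) category" where
  "enveloping_groupoid C =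
     \<lparr>Obj = Obj C,
      Arr = {(x, zz_class C x y w, y) |x w y. zigzag C x w y},
      tgt = (\<lambda>(x, A, y). x),
      src = (\<lambda>(x, A, y). y),
      mul = (\<lambda>(x, A, y) (y', B, z). (x, {w. \<exists>u\<in>A. \<exists>v\<in>B. zz_eq C x z (u @ v) w}, z)),
      ident = (\<lambda>x. (x, zz_class C x x [], x))\<rparr>"

definition fundamental_group ::
  "('o, 'm) category \<Rightarrow> 'o \<Rightarrow> ('o \<times> 'm letter list set \<times> 'o) monoid" where
  "fundamental_group C x = vertex_group (enveloping_groupoid C) x"


section \<open>Orderings of groups\<close>

definition left_ordering :: "('a, 'z) monoid_scheme \<Rightarrow> ('a \<Rightarrow> 'a \<Rightarrow> bool) \<Rightarrow> bool" where
  "left_ordering H r \<longleftrightarrow>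
     irreflp_on (carrier H) r \<and> transp_on (carrier H) r \<and> totalp_on (carrier H) r \<and>
     (\<forall>a\<in>carrier H. \<forall>b\<in>carrier H. \<forall>c\<in>carrier H.
        r b c \<longrightarrow> r (a \<otimes>\<^bsub>H\<^esub> b) (a \<otimes>\<^bsub>H\<^esub> c))"

definition bi_ordering :: "('a, 'z) monoid_scheme \<Rightarrow> ('a \<Rightarrow> 'a \<Rightarrow> bool) \<Rightarrow> bool" where
  "bi_ordering H r \<longleftrightarrow> left_ordering H r \<and>
     (\<forall>a\<in>carrier H. \<forall>b\<in>carrier H. \<forall>c\<in>carrier H.
        r b c \<longrightarrow> r (b \<otimes>\<^bsub>H\<^esub> a) (c \<otimes>\<^bsub>H\<^esub> a))"

definition left_orderable :: "('a, 'z) monoid_scheme \<Rightarrow> bool" where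
  "left_orderable H \<longleftrightarrow> group H \<and> (\<exists>r. left_ordering H r)"

definition bi_orderable :: "('a, 'z) monoid_scheme \<Rightarrow> bool" where
  "bi_orderable H \<longleftrightarrow> group H \<and> (\<exists>r. bi_ordering H r)"


section \<open>Indirect products\<close>

definition wide_subcategory :: "('o, 'm) category \<Rightarrow> ('o, 'm) category \<Rightarrow> bool" where
  "wide_subcategory F C \<longleftrightarrow> category F \<and> category C \<and> Obj F = Obj C \<and> Arr F \<subseteq> Arr C \<and>
     (\<forall>a\<in>Arr F. tgt F a = tgt C a \<and> src F a = src C a) \<and>
     (\<forall>a\<in>Arr F. \<forall>b\<in>Arr F. src F a = tgt F b \<longrightarrow> mul F a b = mul C a b) \<and>
     (\<forall>x\<in>Obj F. ident F x = ident C x)"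

definition indirect_product ::
  "('o, 'm) category \<Rightarrow> ('o, 'm) category \<Rightarrow> ('o, 'm) category \<Rightarrow> bool" where
  "indirect_product C F G \<longleftrightarrow> wide_subcategory F C \<and> wide_subcategory G C \<and>
     (\<forall>c\<in>Arr C. \<exists>!p. fst p \<in> Arr F \<and> snd p \<in> Arr G \<and> src C (fst p) = tgt C (snd p) \<and>
        c = mul C (fst p) (snd p))"

text \<open>
  For \<open>g\<close> in \<open>G\<close> and \<open>f\<close> in \<open>F\<close> with \<open>src C g = tgt C f\<close>, \<open>exchange C F G g f\<close> is the pair
  \<open>(g \<cdot> f, g\<^sup>f)\<close>, i.e. the unique \<open>(f', g')\<close> with \<open>g f = f' g'\<close>.
\<close>

definition exchange ::
  "('o, 'm) category \<Rightarrow> ('o, 'm) category \<Rightarrow> ('o, 'm) category \<Rightarrow> 'm \<Rightarrow> 'm \<Rightarrow> 'm \<times> 'm" where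
  "exchange C F G g f = (THE p. fst p \<in> Arr F \<and> snd p \<in> Arr G \<and> src C (fst p) = tgt C (snd p) \<and>
     mul C g f = mul C (fst p) (snd p))"

definition act_on ::
  "('o, 'm) category \<Rightarrow> ('o, 'm) category \<Rightarrow> ('o, 'm) category \<Rightarrow> 'm \<Rightarrow> 'm \<Rightarrow> 'm" where
  "act_on C F G g f = fst (exchange C F G g f)"

definition act_exp ::
  "('o, 'm) category \<Rightarrow> ('o, 'm) category \<Rightarrow> ('o, 'm) category \<Rightarrow> 'm \<Rightarrow> 'm \<Rightarrow> 'm" where
  "act_exp C F G g f = snd (exchange C F G g f)"

definition pure_product ::
  "('o, 'm) category \<Rightarrow> ('o, 'm) category \<Rightarrow> ('o, 'm) category \<Rightarrow> bool" where
  "pure_product C F G \<longleftrightarrow> discrete_groupoid G \<and>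
     (\<forall>x\<in>Obj C. \<forall>g\<in>Hom G x x. \<forall>f\<in>Arr F. tgt F f = x \<longrightarrow> act_on C F G g f = f)"


section \<open>Discrete orderings of groupoids\<close>

definition discrete_cone ::
  "('o, 'm) category \<Rightarrow> ('k, 'd) category \<Rightarrow> ('o \<Rightarrow> 'k) \<Rightarrow> ('m \<Rightarrow> 'd) \<Rightarrow>
   ('k \<Rightarrow> 'd \<Rightarrow> 'd \<Rightarrow> bool) \<Rightarrow> 'o \<Rightarrow> 'm set" where
  "discrete_cone G D \<phi> \<Phi> prec x =
     {g \<in> Arr (component G x). prec (\<phi> x) (ident D (\<phi> x)) (\<Phi> g)}"

text \<open>
  The last clause is what makes the sets \<open>discrete_cone G D \<phi> \<Phi> prec x\<close> positive cones of an
  ordering of \<open>G\<close>: every non-identity morphism is positive or has a positive inverse. The other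
  properties of positive cones (closure under composition; no morphism is positive together with
  its inverse; identities are not positive) follow from the remaining clauses. The last clause
  does not: it excludes, for instance, that \<open>\<Phi>\<close> maps a group with torsion to the trivial group.
\<close>

definition discrete_left_ordering ::
  "('o, 'm) category \<Rightarrow> ('k, 'd) category \<Rightarrow> ('o \<Rightarrow> 'k) \<Rightarrow> ('m \<Rightarrow> 'd) \<Rightarrow>
   ('k \<Rightarrow> 'd \<Rightarrow> 'd \<Rightarrow> bool) \<Rightarrow> bool" where
  "discrete_left_ordering G D \<phi> \<Phi> prec \<longleftrightarrow>
     groupoid G \<and> discrete_groupoid D \<and>
     (\<forall>k\<in>Obj D. left_ordering (vertex_group D k) (prec k)) \<and>
     is_functor G D \<phi> \<Phi> \<and>
     (\<forall>x\<in>Obj G. \<forall>y\<in>Obj G. Hom G x y \<noteq> {} \<longrightarrow> \<phi> x = \<phi> y) \<and>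
     (\<forall>x\<in>Obj G. \<forall>g\<in>Arr (component G x).
        g = ident G (tgt G g) \<or> g \<in> discrete_cone G D \<phi> \<Phi> prec x \<or>
        arr_inv G g \<in> discrete_cone G D \<phi> \<Phi> prec x)"

definition discrete_bi_ordering ::
  "('o, 'm) category \<Rightarrow> ('k, 'd) category \<Rightarrow> ('o \<Rightarrow> 'k) \<Rightarrow> ('m \<Rightarrow> 'd) \<Rightarrow>
   ('k \<Rightarrow> 'd \<Rightarrow> 'd \<Rightarrow> bool) \<Rightarrow> bool" where
  "discrete_bi_ordering G D \<phi> \<Phi> prec \<longleftrightarrow> discrete_left_ordering G D \<phi> \<Phi> prec \<and>
     (\<forall>k\<in>Obj D. bi_ordering (vertex_group D k) (prec k))"

definition compatible ::
  "('o, 'm) category \<Rightarrow> ('o, 'm) category \<Rightarrow> ('o, 'm) category \<Rightarrow> ('o \<Rightarrow> 'm set) \<Rightarrow> bool" where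
  "compatible C F G P \<longleftrightarrow>
     (\<forall>x\<in>Obj C. \<forall>y\<in>Obj C. \<forall>f\<in>Hom F x y. \<forall>g\<in>Arr G.
        src G g = x \<longrightarrow> g \<in> P x \<longrightarrow> act_exp C F G g f \<in> P y)"


section \<open>The fundamental group is a group\<close>

lemma (in groupoid) group_vertex_group:
  assumes "x \<in> Obj C"
  shows "group (vertex_group C x)"
proof (rule groupI)
  fix a assume "a \<in> carrier (vertex_group C x)"
  then have a: "a \<in> Hom C x x" by (simp add: vertex_group_def)
  then obtain b where "inverse_pair C a b" using invertible by (auto simp: Hom_def)
  with a show "\<exists>b\<in>carrier (vertex_group C x).
      b \<otimes>\<^bsub>vertex_group C x\<^esub> a = \<one>\<^bsub>vertex_group C x\<^esub>"
    by (auto simp: vertex_group_def inverse_pair_def Hom_def)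
qed (use assms in \<open>auto simp: vertex_group_def mul_in_Hom ident_in_Hom mul_ident_left mul_assoc\<close>)

lemma zigzag_append:
  "zigzag C x u y \<Longrightarrow> zigzag C y v z \<Longrightarrow> zigzag C x (u @ v) z"
  by (induction rule: zigzag.induct) (auto intro: zigzag.intros)

lemma zz_eq_cong_left:
  "zz_eq C y z v w \<Longrightarrow> zigzag C x u y \<Longrightarrow> zz_eq C x z (u @ v) (u @ w)"
proof (induction rule: zz_eq.induct)
  case (zz_step y u' p z r s v t)
  then show ?case
    using zz_eq.zz_step[OF zigzag_append[OF zz_step.prems zz_step.hyps(1)] zz_step.hyps(2,3)] by simp
qed (blast intro: zz_eq.intros zigzag_append)+

lemma zz_eq_cong_right:
  "zz_eq C x y v w \<Longrightarrow> zigzag C y u z \<Longrightarrow> zz_eq C x z (v @ u) (w @ u)"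
proof (induction rule: zz_eq.induct)
  case (zz_step x u' p q r s v t)
  then show ?case
    using zz_eq.zz_step[OF zz_step.hyps(1,2) zigzag_append[OF zz_step.hyps(3) zz_step.prems]] by simp
qed (blast intro: zz_eq.intros zigzag_append)+

lemma zz_class_eqI: "zz_eq C x y v w \<Longrightarrow> zz_class C x y v = zz_class C x y w"
  unfolding zz_class_def by (blast intro: zz_sym zz_trans)

fun flip_letter :: "'m letter \<Rightarrow> 'm letter" where
  "flip_letter (Fwd a) = Bwd a"
| "flip_letter (Bwd a) = Fwd a"

lemma flip_flip:
  fixes w :: "'m letter list"
  shows "rev (map flip_letter (rev (map flip_letter w))) = w"
proof -
  have "flip_letter (flip_letter l) = l" for l :: "'m letter"
    by (cases l) simp_all
  then show ?thesis by (simp add: rev_map comp_def)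
qed

context
  fixes C :: "('o, 'm) category"
  assumes cat: "category C"
begin

lemma Hom_in_Obj: "a \<in> Hom C x y \<Longrightarrow> x \<in> Obj C \<and> y \<in> Obj C"
  using cat category.tgt_in_Obj category.src_in_Obj unfolding Hom_def by fastforce

lemma zigzag_in_Obj: "zigzag C x w y \<Longrightarrow> x \<in> Obj C \<and> y \<in> Obj C"
  by (induction rule: zigzag.induct) (auto dest: Hom_in_Obj)

lemma zz_relator_zigzag: "zz_relator C x y r s \<Longrightarrow> zigzag C x r y \<and> zigzag C x s y"
proof (induction rule: zz_relator.induct)
  case (rel_mul a x y b z)
  then show ?case
    using category.mul_in_Hom[OF cat rel_mul] by (auto intro!: zigzag.intros dest: Hom_in_Obj)
next
  case (rel_ident x)
  then show ?case using category.ident_in_Hom[OF cat rel_ident] by (auto intro: zigzag.intros)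
qed (auto intro: zigzag.intros dest: Hom_in_Obj)

lemma zz_eq_zigzag: "zz_eq C x y v w \<Longrightarrow> zigzag C x v y \<and> zigzag C x w y"
proof (induction rule: zz_eq.induct)
  case (zz_step x u y z r s v t)
  then show ?case using zz_relator_zigzag[OF zz_step.hyps(2)] by (blast intro: zigzag_append)
qed blast+

lemma Hom_enveloping:
  "Hom (enveloping_groupoid C) x y = {(x, zz_class C x y w, y) |w. zigzag C x w y}"
  by (auto simp: Hom_def enveloping_groupoid_def)

lemma mul_enveloping:
  assumes u: "zigzag C x u y" and v: "zigzag C y v z"
  shows "mul (enveloping_groupoid C) (x, zz_class C x y u, y) (y, zz_class C y z v, z) =
    (x, zz_class C x z (u @ v), z)"
proof -
  have "zz_eq C x z (u @ v) (u' @ v')" if "zz_eq C x y u u'" "zz_eq C y z v v'" for u' v'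
    using zz_trans[OF zz_eq_cong_right[OF that(1) v] zz_eq_cong_left[OF that(2)]]
      zz_eq_zigzag[OF that(1)] by blast
  then have "(\<exists>u'\<in>zz_class C x y u. \<exists>v'\<in>zz_class C y z v. zz_eq C x z (u' @ v') w) \<longleftrightarrow>
      w \<in> zz_class C x z (u @ v)" for w
    using zz_refl[OF u] zz_refl[OF v] unfolding zz_class_def mem_Collect_eq
    by (blast intro: zz_trans)
  then show ?thesis by (simp add: enveloping_groupoid_def)
qed

lemma category_enveloping: "category (enveloping_groupoid C)"
proof
  show "tgt (enveloping_groupoid C) a \<in> Obj (enveloping_groupoid C)"
    "src (enveloping_groupoid C) a \<in> Obj (enveloping_groupoid C)"
    if "a \<in> Arr (enveloping_groupoid C)" for a
    using that by (auto simp: enveloping_groupoid_def dest: zigzag_in_Obj)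
  show "ident (enveloping_groupoid C) x \<in> Hom (enveloping_groupoid C) x x"
    if "x \<in> Obj (enveloping_groupoid C)" for x
    using that zigzag_Nil[of x C] unfolding Hom_enveloping by (auto simp: enveloping_groupoid_def)
  show "mul (enveloping_groupoid C) a b \<in> Hom (enveloping_groupoid C) x z"
    if "a \<in> Hom (enveloping_groupoid C) x y" "b \<in> Hom (enveloping_groupoid C) y z" for a b x y z
    using that by (auto simp: Hom_enveloping mul_enveloping intro: zigzag_append)
  have id: "ident (enveloping_groupoid C) x = (x, zz_class C x x [], x)" for x
    by (simp add: enveloping_groupoid_def)
  show "mul (enveloping_groupoid C) (ident (enveloping_groupoid C) x) a = a"
    "mul (enveloping_groupoid C) a (ident (enveloping_groupoid C) y) = a"
    if "a \<in> Hom (enveloping_groupoid C) x y" for a x y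
  proof -
    from that obtain w where w: "a = (x, zz_class C x y w, y)" "zigzag C x w y"
      by (auto simp: Hom_enveloping)
    have "zigzag C x [] x" "zigzag C y [] y"
      using zigzag_in_Obj[OF w(2)] by (auto intro: zigzag_Nil)
    then show "mul (enveloping_groupoid C) (ident (enveloping_groupoid C) x) a = a"
      "mul (enveloping_groupoid C) a (ident (enveloping_groupoid C) y) = a"
      using w by (simp_all add: id mul_enveloping)
  qed
  show "mul (enveloping_groupoid C) (mul (enveloping_groupoid C) a b) c =
      mul (enveloping_groupoid C) a (mul (enveloping_groupoid C) b c)"
    if "a \<in> Hom (enveloping_groupoid C) w x" "b \<in> Hom (enveloping_groupoid C) x y"
      "c \<in> Hom (enveloping_groupoid C) y z" for a b c w x y z
    using that by (auto simp: Hom_enveloping mul_enveloping zigzag_append)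
qed

lemma zigzag_flip: "zigzag C x w y \<Longrightarrow> zigzag C y (rev (map flip_letter w)) x"
proof (induction rule: zigzag.induct)
  case (zigzag_Nil x)
  then show ?case by (simp add: zigzag.zigzag_Nil)
next
  case (zigzag_Fwd a x y w z)
  then have "zigzag C y [Bwd a] x" by (auto intro: zigzag.intros dest: Hom_in_Obj)
  with zigzag_Fwd show ?case by (simp add: zigzag_append)
next
  case (zigzag_Bwd a y x w z)
  then have "zigzag C y [Fwd a] x" by (auto intro: zigzag.intros dest: Hom_in_Obj)
  with zigzag_Bwd show ?case by (simp add: zigzag_append)
qed

lemma zz_relator_eq: "zz_relator C x y r s \<Longrightarrow> zz_eq C x y r s"
  using zz_step[of C x "[]" x y r s "[]" y] zz_relator_zigzag[of x y r s] zigzag_in_Obj[of x r y]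
  by (simp add: zigzag_Nil)

lemma zz_eq_flip_right: "zigzag C x w y \<Longrightarrow> zz_eq C x x (w @ rev (map flip_letter w)) []"
proof (induction rule: zigzag.induct)
  case (zigzag_Nil x)
  then show ?case by (simp add: zz_refl zigzag.zigzag_Nil)
next
  case (zigzag_Fwd a x y w z)
  then have "zigzag C x [Fwd a] y" "zigzag C y [Bwd a] x"
    by (auto intro: zigzag.intros dest: Hom_in_Obj)
  from zz_eq_cong_left[OF zz_eq_cong_right[OF zigzag_Fwd.IH this(2)] this(1)]
  show ?case using zz_relator_eq[OF rel_Fwd_Bwd[OF zigzag_Fwd.hyps(1)]] by (simp add: zz_trans)
next
  case (zigzag_Bwd a y x w z)
  then have "zigzag C x [Bwd a] y" "zigzag C y [Fwd a] x"
    by (auto intro: zigzag.intros dest: Hom_in_Obj)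
  from zz_eq_cong_left[OF zz_eq_cong_right[OF zigzag_Bwd.IH this(2)] this(1)]
  show ?case using zz_relator_eq[OF rel_Bwd_Fwd[OF zigzag_Bwd.hyps(1)]] by (simp add: zz_trans)
qed

lemma groupoid_enveloping: "groupoid (enveloping_groupoid C)"
proof (intro groupoid.intro category_enveloping groupoid_axioms.intro)
  fix a assume "a \<in> Arr (enveloping_groupoid C)"
  then obtain x w y where a: "a = (x, zz_class C x y w, y)" and w: "zigzag C x w y"
    by (auto simp: enveloping_groupoid_def)
  let ?v = "rev (map flip_letter w)"
  have v: "zigzag C y ?v x" using zigzag_flip[OF w] .
  have "zz_eq C x x (w @ ?v) []" "zz_eq C y y (?v @ w) []"
    using zz_eq_flip_right[OF w] zz_eq_flip_right[OF v] by (simp_all only: flip_flip)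
  note eq = this[THEN zz_class_eqI]
  have "a \<in> Hom (enveloping_groupoid C) x y"
    "(y, zz_class C y x ?v, x) \<in> Hom (enveloping_groupoid C) y x"
    using a w v by (auto simp: Hom_enveloping)
  moreover have "mul (enveloping_groupoid C) a (y, zz_class C y x ?v, x) = (x, zz_class C x x [], x)"
    "mul (enveloping_groupoid C) (y, zz_class C y x ?v, x) a = (y, zz_class C y y [], y)"
    unfolding a mul_enveloping[OF w v] mul_enveloping[OF v w] eq by (rule refl)+
  moreover have "ident (enveloping_groupoid C) z = (z, zz_class C z z [], z)" for z
    by (simp add: enveloping_groupoid_def)
  ultimately have "inverse_pair (enveloping_groupoid C) a (y, zz_class C y x ?v, x)"
    unfolding inverse_pair_def Hom_def by simp
  then show "\<exists>b. inverse_pair (enveloping_groupoid C) a b" ..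
qed

lemma group_fundamental_group: "x \<in> Obj C \<Longrightarrow> group (fundamental_group C x)"
  unfolding fundamental_group_def
  by (rule groupoid.group_vertex_group[OF groupoid_enveloping])
    (simp add: enveloping_groupoid_def)

end

end

theory Submission
  imports Defs
begin

text \<open>
  In a right-Ore category \<open>C\<close> every element of \<open>\<Pi>(C, \<epsilon>)\<close> is a right fraction \<open>a b\<inverse>\<close> with
  \<open>a, b \<in> C(\<epsilon>, y)\<close>, unique up to expansion \<open>(a k) (b k)\<inverse>\<close>. Hence left-orderings of \<open>\<Pi>(C, \<epsilon>)\<close>
  amount to families of linear orders on the sets \<open>C(\<epsilon>, y)\<close> that are invariant under right
  multiplication: \<open>a < b\<close> says that \<open>b a\<inverse>\<close> is positive. Now factor morphisms of \<open>F \<bowtie> G\<close> as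
  \<open>f g\<close>, compare \<open>G\<close>-parts by \<open>g < h\<close> iff \<open>h g\<inverse>\<close> lies in the positive cone, and
  \<open>F\<close>-parts by the order coming from \<open>\<Pi>(F, \<epsilon>)\<close>; note that \<open>F\<close> is again right-Ore.
  For left-orderability order lexicographically with the \<open>G\<close>-part first: compatibility with \<open>F\<close>
  gives invariance. For bi-orderability the \<open>F\<close>-part comes first: by purity it is multiplicative,
  so \<open>\<Pi>(F \<bowtie> G, \<epsilon>)\<close> is an extension of \<open>\<Pi>(F, \<epsilon>)\<close> whose kernel consists of the \<open>f g f\<inverse>\<close>.
\<close>

section \<open>Positive cones of groups\<close>

lemma (in group) mult_inv_mult: "b \<in> carrier G \<Longrightarrow> c \<in> carrier G \<Longrightarrow> b \<otimes> (inv b \<otimes> c) = c"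
  by (metis m_assoc r_inv l_one inv_closed)

lemma (in group) inv_mult_mult: "b \<in> carrier G \<Longrightarrow> c \<in> carrier G \<Longrightarrow> inv b \<otimes> (b \<otimes> c) = c"
  using mult_inv_mult[of "inv b" c] by simp

text \<open>The order compares elements by quotients: \<open>inv a \<otimes> b\<close> and
  \<open>inv b \<otimes> c\<close> multiply to \<open>inv a \<otimes> c\<close>, which turns closure
  into transitivity, and a common left factor cancels from a quotient.\<close>

lemma (in group) left_ordering_of_cone:
  assumes P: "P \<subseteq> carrier G" and closed: "\<And>a b. a \<in> P \<Longrightarrow> b \<in> P \<Longrightarrow> a \<otimes> b \<in> P"
    and one: "\<one> \<notin> P" and total: "\<And>a. a \<in> carrier G \<Longrightarrow> a = \<one> \<or> a \<in> P \<or> inv a \<in> P"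
  shows "left_ordering G (\<lambda>a b. inv a \<otimes> b \<in> P)"
  unfolding left_ordering_def
proof (intro conjI ballI impI)
  show "irreflp_on (carrier G) (\<lambda>a b. inv a \<otimes> b \<in> P)"
    using one by (auto intro!: irreflp_onI)
  show "transp_on (carrier G) (\<lambda>a b. inv a \<otimes> b \<in> P)"
  proof (rule transp_onI)
    fix a b c
    assume c: "a \<in> carrier G" "b \<in> carrier G" "c \<in> carrier G"
      and "inv a \<otimes> b \<in> P" "inv b \<otimes> c \<in> P"
    then have "(inv a \<otimes> b) \<otimes> (inv b \<otimes> c) \<in> P" by (simp add: closed)
    also have "(inv a \<otimes> b) \<otimes> (inv b \<otimes> c) = inv a \<otimes> c"
      using c by (simp add: m_assoc mult_inv_mult)
    finally show "inv a \<otimes> c \<in> P" .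
  qed
  show "totalp_on (carrier G) (\<lambda>a b. inv a \<otimes> b \<in> P)"
  proof (rule totalp_onI)
    fix a b
    assume c: "a \<in> carrier G" "b \<in> carrier G" "a \<noteq> b"
    then have "inv a \<otimes> b \<noteq> \<one>" by (metis inv_closed inv_equality inv_inv)
    then show "inv a \<otimes> b \<in> P \<or> inv b \<otimes> a \<in> P"
      using total[of "inv a \<otimes> b"] c by (simp add: inv_mult_group)
  qed
next
  fix a b c
  assume c: "a \<in> carrier G" "b \<in> carrier G" "c \<in> carrier G" "inv b \<otimes> c \<in> P"
  then have "inv (a \<otimes> b) \<otimes> (a \<otimes> c) = inv b \<otimes> c"
    by (simp add: inv_mult_group m_assoc inv_mult_mult)
  with c show "inv (a \<otimes> b) \<otimes> (a \<otimes> c) \<in> P" by simp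
qed

text \<open>Multiplying \<open>b\<close> and \<open>c\<close> on the right by \<open>a\<close>
  conjugates the quotient \<open>inv b \<otimes> c\<close> by \<open>a\<close>.\<close>

lemma (in group) bi_ordering_of_cone:
  assumes P: "P \<subseteq> carrier G" and closed: "\<And>a b. a \<in> P \<Longrightarrow> b \<in> P \<Longrightarrow> a \<otimes> b \<in> P"
    and one: "\<one> \<notin> P" and total: "\<And>a. a \<in> carrier G \<Longrightarrow> a = \<one> \<or> a \<in> P \<or> inv a \<in> P"
    and conj: "\<And>a p. a \<in> carrier G \<Longrightarrow> p \<in> P \<Longrightarrow> inv a \<otimes> p \<otimes> a \<in> P"
  shows "bi_ordering G (\<lambda>a b. inv a \<otimes> b \<in> P)"
  unfolding bi_ordering_def
proof (intro conjI ballI impI)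
  show "left_ordering G (\<lambda>a b. inv a \<otimes> b \<in> P)"
    by (rule left_ordering_of_cone[OF P closed one total])
next
  fix a b c
  assume c: "a \<in> carrier G" "b \<in> carrier G" "c \<in> carrier G" "inv b \<otimes> c \<in> P"
  then have "inv (b \<otimes> a) \<otimes> (c \<otimes> a) = inv a \<otimes> (inv b \<otimes> c) \<otimes> a"
    by (simp add: inv_mult_group m_assoc)
  with c conj show "inv (b \<otimes> a) \<otimes> (c \<otimes> a) \<in> P" by simp
qed

section \<open>Positive elements of ordered groups\<close>

context group
begin

context
  fixes r
  assumes r: "left_ordering G r"
begin

lemma left_ordering_mult:
  "a \<in> carrier G \<Longrightarrow> b \<in> carrier G \<Longrightarrow> c \<in> carrier G \<Longrightarrow> r b c \<Longrightarrow> r (a \<otimes> b) (a \<otimes> c)"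
  using r unfolding left_ordering_def by blast

lemma left_ordering_irrefl: "a \<in> carrier G \<Longrightarrow> \<not> r a a"
  using r unfolding left_ordering_def by (auto dest: irreflp_onD)

lemma left_ordering_pos_mult:
  assumes "a \<in> carrier G" "b \<in> carrier G" "r \<one> a" "r \<one> b"
  shows "r \<one> (a \<otimes> b)"
proof -
  have "r a (a \<otimes> b)" using left_ordering_mult[of a \<one> b] assms by simp
  then show ?thesis using r assms unfolding left_ordering_def by (auto dest: transp_onD)
qed

lemma left_ordering_pos_total:
  assumes "a \<in> carrier G" "a \<noteq> \<one>"
  shows "r \<one> a \<or> r \<one> (inv a)"
proof -
  have "r \<one> a \<or> r a \<one>"
    using r assms unfolding left_ordering_def by (auto dest: totalp_onD)
  then show ?thesis using left_ordering_mult[of "inv a" a \<one>] assms by auto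
qed

end

text \<open>Multiply the inequality between \<open>\<one>\<close> and \<open>p\<close> by
  \<open>a\<close> on the left, then by \<open>inv a\<close> on the right.\<close>

lemma bi_ordering_pos_conj:
  assumes r: "bi_ordering G r" and "a \<in> carrier G" "p \<in> carrier G" "r \<one> p"
  shows "r \<one> (a \<otimes> p \<otimes> inv a)"
proof -
  have "r (a \<otimes> \<one>) (a \<otimes> p)"
    using assms left_ordering_mult[of r a \<one> p] unfolding bi_ordering_def by blast
  moreover have "a \<otimes> \<one> \<in> carrier G" "a \<otimes> p \<in> carrier G" "inv a \<in> carrier G"
    using assms by simp_all
  ultimately have "r (a \<otimes> \<one> \<otimes> inv a) (a \<otimes> p \<otimes> inv a)"
    using r unfolding bi_ordering_def by blast
  then show ?thesis using assms by simp
qed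

end


section \<open>Groups of right fractions\<close>

text \<open>\<open>zz_acts C w a b\<close> says that \<open>a = w b\<close>, all intermediate products being morphisms of \<open>C\<close>.\<close>

fun zz_acts :: "('o, 'm) category \<Rightarrow> 'm letter list \<Rightarrow> 'm \<Rightarrow> 'm \<Rightarrow> bool" where
  "zz_acts C [] a b \<longleftrightarrow> a = b"
| "zz_acts C (Fwd c # w) a b \<longleftrightarrow>
     (\<exists>d\<in>Arr C. tgt C d = src C c \<and> a = mul C c d \<and> zz_acts C w d b)"
| "zz_acts C (Bwd c # w) a b \<longleftrightarrow>
     a \<in> Arr C \<and> tgt C a = src C c \<and> zz_acts C w (mul C c a) b"

text \<open>This is the group element \<open>a b^-1\<close>, given by a zigzag through the common
  source of \<open>a\<close> and \<open>b\<close>. It is meaningful only when both lie in the same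
  \<open>Hom C x y\<close>, which later lemmas assume.\<close>

definition fraction :: "('o, 'm) category \<Rightarrow> 'o \<Rightarrow> 'm \<Rightarrow> 'm \<Rightarrow> 'o \<times> 'm letter list set \<times> 'o" where
  "fraction C x a b = (x, zz_class C x x [Fwd a, Bwd b], x)"

section \<open>The partial action of zigzags on the morphisms of a right-Ore category\<close>

context
  fixes C :: "('o, 'm) category"
  assumes ore: "right_ore C"
begin

lemma ore_category: "category C"
  using ore unfolding right_ore_def by blast

interpretation category C by (rule ore_category)

lemma ore_cancel_left:
  assumes "a \<in> Hom C x y" "b \<in> Hom C y z" "c \<in> Hom C y z'" "mul C a b = mul C a c"
  shows "b = c"
proof -
  have "a \<in> Arr C" "b \<in> Arr C" "c \<in> Arr C" "src C a = tgt C b" "src C a = tgt C c"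
    using assms by (auto simp: Hom_def)
  with assms(4) ore show ?thesis unfolding right_ore_def cancellative_def by blast
qed

lemma ore_cancel_right:
  assumes "a \<in> Hom C x y" "c \<in> Hom C x' y" "b \<in> Hom C y z" "mul C a b = mul C c b"
  shows "a = c"
proof -
  have "a \<in> Arr C" "b \<in> Arr C" "c \<in> Arr C" "src C a = tgt C b" "src C c = tgt C b"
    using assms by (auto simp: Hom_def)
  with assms(4) ore show ?thesis unfolding right_ore_def cancellative_def by blast
qed

lemma ore_common_multiple:
  assumes "a \<in> Hom C x y" "b \<in> Hom C x z"
  obtains t k l where "k \<in> Hom C y t" "l \<in> Hom C z t" "mul C a k = mul C b l"
proof -
  from assms have ab: "a \<in> Arr C" "b \<in> Arr C" "tgt C a = tgt C b" by (auto simp: Hom_def)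
  with ore obtain k l where k: "k \<in> Arr C" "l \<in> Arr C" "src C a = tgt C k" "src C b = tgt C l"
    "mul C a k = mul C b l"
    unfolding right_ore_def by meson
  with assms have "mul C a k \<in> Hom C x (src C k)" "mul C b l \<in> Hom C x (src C l)"
    using mul_in_Hom[of a x y k "src C k"] mul_in_Hom[of b x z l "src C l"] by (auto simp: Hom_def)
  with k(5) have "src C k = src C l" by (auto simp: Hom_def)
  with k assms have "k \<in> Hom C y (src C k)" "l \<in> Hom C z (src C k)" by (simp_all add: Hom_def)
  then show thesis using that k(5) by blast
qed

lemma zz_acts_Hom:
  "zigzag C x w y \<Longrightarrow> b \<in> Hom C y z \<Longrightarrow> zz_acts C w a b \<Longrightarrow> a \<in> Hom C x z"
proof (induction arbitrary: a rule: zigzag.induct)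
  case (zigzag_Fwd c x y w z')
  then obtain d where d: "a = mul C c d" "zz_acts C w d b" by auto
  show ?case
    unfolding d(1) by (rule mul_in_Hom[OF zigzag_Fwd.hyps(1) zigzag_Fwd.IH[OF zigzag_Fwd.prems(1) d(2)]])
next
  case (zigzag_Bwd c y x w z')
  have a: "a \<in> Hom C x (src C a)" "mul C c a \<in> Hom C y z"
    using zigzag_Bwd.hyps(1) zigzag_Bwd.prems(2) zigzag_Bwd.IH[OF zigzag_Bwd.prems(1)]
    by (simp_all add: Hom_def)
  have "mul C c a \<in> Hom C y (src C a)" by (rule mul_in_Hom[OF zigzag_Bwd.hyps(1) a(1)])
  with a show ?case by (simp add: Hom_def)
qed simp

text \<open>Every letter acts as a partial function; for a backward letter this is left
  cancellation.\<close>

lemma zz_acts_functional: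
  "zigzag C x w y \<Longrightarrow> b \<in> Hom C y z \<Longrightarrow> zz_acts C w a b \<Longrightarrow> zz_acts C w a' b \<Longrightarrow> a = a'"
proof (induction arbitrary: a a' rule: zigzag.induct)
  case (zigzag_Bwd c y x w z')
  then have "mul C c a = mul C c a'" by auto
  moreover have "a \<in> Hom C x (src C a)" "a' \<in> Hom C x (src C a')"
    using zigzag_Bwd by (auto simp: Hom_def)
  ultimately show ?case using ore_cancel_left zigzag_Bwd.hyps(1) by blast
qed auto

lemma zz_acts_append: "zz_acts C (u @ v) a b \<longleftrightarrow> (\<exists>c. zz_acts C u a c \<and> zz_acts C v c b)"
proof (induction u arbitrary: a)
  case (Cons l u)
  then show ?case by (cases l) auto
qed simp

text \<open>Zigzags act from the left, so by associativity the action commutes with right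
  multiplication.\<close>

lemma zz_acts_mul_right:
  "zigzag C x w y \<Longrightarrow> b \<in> Hom C y z \<Longrightarrow> k \<in> Hom C z t \<Longrightarrow> zz_acts C w a b \<Longrightarrow>
    zz_acts C w (mul C a k) (mul C b k)"
proof (induction arbitrary: a rule: zigzag.induct)
  case (zigzag_Fwd c x y w z')
  then obtain d where d: "a = mul C c d" "zz_acts C w d b" by auto
  then have "d \<in> Hom C y z" using zz_acts_Hom zigzag_Fwd by blast
  moreover from this have "mul C d k \<in> Hom C y t" using zigzag_Fwd.prems(2) by (rule mul_in_Hom)
  ultimately show ?case
    using zigzag_Fwd d by (auto simp: Hom_def intro!: bexI[of _ "mul C d k"] mul_assoc)
next
  case (zigzag_Bwd c y x w z')
  have "zigzag C x (Bwd c # w) z'" using zigzag_Bwd by (blast intro: zigzag.zigzag_Bwd)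
  then have a: "a \<in> Hom C x z" using zz_acts_Hom zigzag_Bwd by blast
  then have "mul C a k \<in> Hom C x t" using zigzag_Bwd.prems(2) by (rule mul_in_Hom)
  moreover have "mul C (mul C c a) k = mul C c (mul C a k)"
    by (rule mul_assoc[OF zigzag_Bwd.hyps(1) a zigzag_Bwd.prems(2)])
  ultimately show ?case
    using zigzag_Bwd.IH[OF zigzag_Bwd.prems(1,2), of "mul C c a"] zigzag_Bwd.hyps zigzag_Bwd.prems
    by (auto simp: Hom_def)
qed simp

text \<open>A zigzag may fail to act on \<open>b\<close>, because a backward letter requires
  divisibility. Common right multiples supply it once \<open>b\<close> is multiplied by a suitable
  \<open>k\<close>.\<close>

lemma zz_acts_cofinal:
  "zigzag C x w y \<Longrightarrow> b \<in> Hom C y z \<Longrightarrow> \<exists>t. \<exists>k\<in>Hom C z t. \<exists>a. zz_acts C w a (mul C b k)"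
proof (induction rule: zigzag.induct)
  case (zigzag_Nil x)
  then show ?case using ident_in_Hom Hom_in_Obj[OF ore_category] by fastforce
next
  case (zigzag_Fwd c x y w z')
  then obtain t k a where k: "k \<in> Hom C z t" "zz_acts C w a (mul C b k)" by blast
  have "mul C b k \<in> Hom C z' t" by (rule mul_in_Hom[OF zigzag_Fwd.prems k(1)])
  with k have "a \<in> Hom C y t" using zz_acts_Hom zigzag_Fwd by blast
  with k zigzag_Fwd.hyps show ?case
    by (intro exI[of _ t] bexI[of _ k] exI[of _ "mul C c a"]) (auto simp: Hom_def)
next
  case (zigzag_Bwd c y x w z')
  then obtain t k a where k: "k \<in> Hom C z t" "zz_acts C w a (mul C b k)" by blast
  have bk: "mul C b k \<in> Hom C z' t" by (rule mul_in_Hom[OF zigzag_Bwd.prems k(1)])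
  with k have "a \<in> Hom C y t" using zz_acts_Hom zigzag_Bwd by blast
  \<comment> \<open>To undo \<open>c\<close>, the result \<open>a\<close> of the remaining word has
    to become a right multiple of \<open>c\<close>; multiplying by \<open>l\<close> achieves
    this.\<close>
  with zigzag_Bwd.hyps obtain s l m where
    l: "l \<in> Hom C t s" "m \<in> Hom C x s" "mul C a l = mul C c m"
    using ore_common_multiple by metis
  have "zz_acts C w (mul C a l) (mul C (mul C b k) l)"
    using zz_acts_mul_right zigzag_Bwd.hyps(2) bk l(1) k(2) by blast
  then have "zz_acts C w (mul C c m) (mul C b (mul C k l))"
    unfolding l(3) mul_assoc[OF zigzag_Bwd.prems k(1) l(1)] .
  moreover have "mul C k l \<in> Hom C z s" by (rule mul_in_Hom[OF k(1) l(1)])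
  ultimately show ?case
    using l zigzag_Bwd.hyps
    by (intro exI[of _ s] bexI[of _ "mul C k l"] exI[of _ m]) (auto simp: Hom_def)
qed

text \<open>Only this direction holds in general: \<open>[Fwd a, Bwd a]\<close> acts just on right
  multiples of \<open>a\<close>, whereas the empty word acts on everything.\<close>

lemma zz_relator_acts:
  assumes "zz_relator C x y r s" "b \<in> Hom C y z" "zz_acts C r a b"
  shows "zz_acts C s a b"
  using assms
proof (induction rule: zz_relator.induct)
  case (rel_mul c x y d w)
  then have "mul C (mul C c d) b = mul C c (mul C d b)" by (intro mul_assoc)
  moreover have "mul C c d \<in> Hom C x w" by (rule mul_in_Hom[OF rel_mul(1,2)])
  ultimately show ?case using rel_mul by (auto simp: Hom_def)
next
  case (rel_ident x)
  then show ?case using mul_ident_left by auto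
next
  case (rel_Bwd_Fwd c x y)
  then have "mul C c a = mul C c b" "a \<in> Hom C y (src C a)" by (auto simp: Hom_def)
  then show ?case using ore_cancel_left rel_Bwd_Fwd by fastforce
qed auto

text \<open>The invariant that separates classes of zigzags: equivalent words agree wherever both
  act. Agreement of domains cannot be claimed, as the relators already change them.\<close>

lemma zz_eq_acts_functional:
  "zz_eq C x y u v \<Longrightarrow> b \<in> Hom C y z \<Longrightarrow> zz_acts C u a b \<Longrightarrow> zz_acts C v a' b \<Longrightarrow> a = a'"
proof (induction arbitrary: a a' b z rule: zz_eq.induct)
  case (zz_refl x w y)
  then show ?case using zz_acts_functional by blast
next
  case (zz_sym x y v w)
  then show ?case by metis
next
  case (zz_trans x y u v w)
  have zz: "zigzag C x u y" "zigzag C x v y" "zigzag C x w y"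
    using zz_eq_zigzag[OF ore_category] zz_trans.hyps by blast+
  \<comment> \<open>The middle word need not act on \<open>b\<close>, so \<open>b\<close> is first
    multiplied by some \<open>k\<close> for which it does; right cancellation removes
    \<open>k\<close> at the end.\<close>
  then obtain t k c where k: "k \<in> Hom C z t" and c: "zz_acts C v c (mul C b k)"
    using zz_acts_cofinal zz_trans.prems(1) by metis
  have bk: "mul C b k \<in> Hom C y t" by (rule mul_in_Hom[OF zz_trans.prems(1) k])
  have "mul C a k = c"
    using zz_trans.IH(1)[OF bk] c zz_acts_mul_right[OF zz(1) zz_trans.prems(1) k] zz_trans.prems
    by blast
  moreover have "c = mul C a' k"
    using zz_trans.IH(2)[OF bk] c zz_acts_mul_right[OF zz(3) zz_trans.prems(1) k] zz_trans.prems
    by blast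
  moreover have "a \<in> Hom C x z" "a' \<in> Hom C x z"
    using zz_acts_Hom zz zz_trans.prems by blast+
  ultimately show ?case using ore_cancel_right k by metis
next
  case (zz_step x u y z' r s v t)
  from zz_step.prems obtain c d where
    cd: "zz_acts C u a c" "zz_acts C r c d" "zz_acts C v d b"
    by (auto simp: zz_acts_append)
  then have "d \<in> Hom C z' z" using zz_acts_Hom zz_step by blast
  with cd have "zz_acts C s c d" using zz_relator_acts zz_step.hyps(2) by blast
  with cd have "zz_acts C (u @ s @ v) a b" unfolding zz_acts_append by blast
  moreover have "zigzag C x (u @ s @ v) t"
    using zz_eq_zigzag[OF ore_category zz_eq.zz_step[OF zz_step.hyps]] by blast
  ultimately show ?case using zz_acts_functional zz_step.prems by blast
qed

section \<open>Calculus of right fractions\<close>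

lemma zigzag_Fwd_Bwd: "a \<in> Hom C x y \<Longrightarrow> b \<in> Hom C z y \<Longrightarrow> zigzag C x [Fwd a, Bwd b] z"
  by (meson Hom_in_Obj[OF ore_category] zigzag.intros)

lemma zigzag_Fwd1: "a \<in> Hom C x y \<Longrightarrow> zigzag C x [Fwd a] y"
  by (meson Hom_in_Obj[OF ore_category] zigzag.intros)

lemma zigzag_Bwd1: "a \<in> Hom C y x \<Longrightarrow> zigzag C x [Bwd a] y"
  by (meson Hom_in_Obj[OF ore_category] zigzag.intros)

text \<open>A form of \<open>zz_step\<close> that leaves the splittings of the two words as side
  conditions, so that explicit lists of letters can be rewritten.\<close>

lemma zz_eq_relator:
  assumes "zz_relator C y z r s" "zigzag C x u y" "zigzag C z v t"
    and "w = u @ r @ v" "w' = u @ s @ v"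
  shows "zz_eq C x t w w'"
  unfolding assms(4,5) using assms(2,1,3) by (rule zz_step)

text \<open>Inserting \<open>b^-1 b\<close> between \<open>a\<close> and \<open>k\<close> turns
  \<open>(a k) (b k)^-1\<close> into \<open>a b^-1 (b k) (b k)^-1\<close>, whose last two factors
  cancel.\<close>

lemma zz_eq_expand:
  assumes a: "a \<in> Hom C x y" and b: "b \<in> Hom C z y" and k: "k \<in> Hom C y t"
  shows "zz_eq C x z [Fwd a, Bwd b] [Fwd (mul C a k), Bwd (mul C b k)]"
proof -
  note [trans] = zz_trans
  have bk: "mul C b k \<in> Hom C z t" using b k by (rule mul_in_Hom)
  have z: "zigzag C z [] z" using Hom_in_Obj[OF ore_category b] by (simp add: zigzag_Nil)
  have "zz_eq C x z [Fwd (mul C a k), Bwd (mul C b k)] [Fwd a, Fwd k, Bwd (mul C b k)]"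
    by (rule zz_sym, rule zz_eq_relator[OF rel_mul[OF a k], of _ "[]" "[Bwd (mul C b k)]"])
      (auto intro: zigzag_Bwd1[OF bk] zigzag_Nil simp: Hom_in_Obj[OF ore_category a])
  also have "zz_eq C x z \<dots> [Fwd a, Bwd b, Fwd b, Fwd k, Bwd (mul C b k)]"
    by (rule zz_sym, rule zz_eq_relator[OF rel_Bwd_Fwd[OF b], of _ "[Fwd a]" "[Fwd k, Bwd (mul C b k)]"])
      (auto intro: zigzag_Fwd1[OF a] zigzag_Fwd_Bwd[OF k bk])
  also have "zz_eq C x z \<dots> [Fwd a, Bwd b, Fwd (mul C b k), Bwd (mul C b k)]"
    by (rule zz_eq_relator[OF rel_mul[OF b k], of _ "[Fwd a, Bwd b]" "[Bwd (mul C b k)]"])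
      (auto intro: zigzag_Bwd1[OF bk] zigzag_Fwd_Bwd[OF a b])
  also have "zz_eq C x z \<dots> [Fwd a, Bwd b]"
    by (rule zz_eq_relator[OF rel_Fwd_Bwd[OF bk], of _ "[Fwd a, Bwd b]" "[]"])
      (auto intro: zigzag_Fwd_Bwd[OF a b] z)
  finally show ?thesis by (rule zz_sym)
qed

text \<open>For the forward direction take a common multiple \<open>b k = d l\<close>. Both words
  act on it, with results \<open>a k\<close> and \<open>c l\<close>, and equivalence forces these to
  coincide. Conversely, both fractions expand to the same one.\<close>

lemma zz_eq_fraction_iff:
  assumes a: "a \<in> Hom C x y" and b: "b \<in> Hom C z y" and c: "c \<in> Hom C x y'" and d: "d \<in> Hom C z y'"
  shows "zz_eq C x z [Fwd a, Bwd b] [Fwd c, Bwd d] \<longleftrightarrow>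
    (\<exists>t. \<exists>k\<in>Hom C y t. \<exists>l\<in>Hom C y' t. mul C a k = mul C c l \<and> mul C b k = mul C d l)"
proof
  assume eq: "zz_eq C x z [Fwd a, Bwd b] [Fwd c, Bwd d]"
  obtain t k l where k: "k \<in> Hom C y t" and l: "l \<in> Hom C y' t" and kl: "mul C b k = mul C d l"
    using ore_common_multiple b d by metis
  have "zz_acts C [Fwd a, Bwd b] (mul C a k) (mul C b k)"
    "zz_acts C [Fwd c, Bwd d] (mul C c l) (mul C d l)"
    using a b c d k l by (auto simp: Hom_def)
  with eq kl have "mul C a k = mul C c l"
    using zz_eq_acts_functional mul_in_Hom[OF b k] by metis
  with k l kl show "\<exists>t. \<exists>k\<in>Hom C y t. \<exists>l\<in>Hom C y' t. mul C a k = mul C c l \<and> mul C b k = mul C d l"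
    by blast
next
  assume "\<exists>t. \<exists>k\<in>Hom C y t. \<exists>l\<in>Hom C y' t. mul C a k = mul C c l \<and> mul C b k = mul C d l"
  then show "zz_eq C x z [Fwd a, Bwd b] [Fwd c, Bwd d]"
    using zz_eq_expand[OF a b] zz_eq_expand[OF c d] by (metis zz_sym zz_trans)
qed

text \<open>A forward letter is absorbed into the numerator. A backward letter is moved past the
  numerator by the Ore condition: \<open>a k = c l\<close> gives
  \<open>c^-1 a = l k^-1\<close>.\<close>

lemma zigzag_fraction:
  "zigzag C x w y \<Longrightarrow> \<exists>z. \<exists>a\<in>Hom C x z. \<exists>b\<in>Hom C y z. zz_eq C x y w [Fwd a, Bwd b]"
proof (induction rule: zigzag.induct)
  case (zigzag_Nil x)
  then have "ident C x \<in> Hom C x x" by (rule ident_in_Hom)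
  with rel_Fwd_Bwd[OF this] show ?case
    using zz_sym[OF zz_relator_eq[OF ore_category]] by blast
next
  case (zigzag_Fwd c x y w z')
  then obtain z a b where ab: "a \<in> Hom C y z" "b \<in> Hom C z' z" "zz_eq C y z' w [Fwd a, Bwd b]"
    by blast
  note [trans] = zz_trans
  have "zz_eq C x z' (Fwd c # w) [Fwd c, Fwd a, Bwd b]"
    using zz_eq_cong_left[OF ab(3) zigzag_Fwd1[OF zigzag_Fwd.hyps(1)]] by simp
  also have "zz_eq C x z' \<dots> [Fwd (mul C c a), Bwd b]"
    by (rule zz_eq_relator[OF rel_mul[OF zigzag_Fwd.hyps(1) ab(1)], of _ "[]" "[Bwd b]"])
      (auto intro: zigzag_Bwd1[OF ab(2)] zigzag_Nil simp: Hom_in_Obj[OF ore_category zigzag_Fwd.hyps(1)])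
  finally show ?case using ab mul_in_Hom[OF zigzag_Fwd.hyps(1)] by blast
next
  case (zigzag_Bwd c y x w z')
  then obtain z a b where ab: "a \<in> Hom C y z" "b \<in> Hom C z' z" "zz_eq C y z' w [Fwd a, Bwd b]"
    by blast
  note [trans] = zz_trans
  obtain t k l where k: "k \<in> Hom C z t" and l: "l \<in> Hom C x t" and kl: "mul C a k = mul C c l"
    using ore_common_multiple ab(1) zigzag_Bwd.hyps(1) by metis
  have bk: "mul C b k \<in> Hom C z' t" using mul_in_Hom[OF ab(2) k] .
  have "zz_eq C y z' w [Fwd (mul C c l), Bwd (mul C b k)]"
    using zz_trans[OF ab(3) zz_eq_expand[OF ab(1,2) k]] kl by simp
  then have "zz_eq C x z' (Bwd c # w) [Bwd c, Fwd (mul C c l), Bwd (mul C b k)]"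
    using zz_eq_cong_left[OF _ zigzag_Bwd1[OF zigzag_Bwd.hyps(1)]] by fastforce
  also have "zz_eq C x z' \<dots> [Bwd c, Fwd c, Fwd l, Bwd (mul C b k)]"
    by (rule zz_sym, rule zz_eq_relator[OF rel_mul[OF zigzag_Bwd.hyps(1) l], of _ "[Bwd c]" "[Bwd (mul C b k)]"])
      (auto intro: zigzag_Bwd1[OF bk] zigzag_Bwd1[OF zigzag_Bwd.hyps(1)])
  also have "zz_eq C x z' \<dots> [Fwd l, Bwd (mul C b k)]"
    by (rule zz_eq_relator[OF rel_Bwd_Fwd[OF zigzag_Bwd.hyps(1)], of _ "[]" "[Fwd l, Bwd (mul C b k)]"])
      (auto intro: zigzag_Fwd_Bwd[OF l bk] zigzag_Nil simp: Hom_in_Obj[OF ore_category l])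
  finally show ?case using l bk by blast
qed

section \<open>The fundamental group as a group of fractions\<close>

lemma carrier_fundamental_group:
  "carrier (fundamental_group C x) = {fraction C x a b |a b z. a \<in> Hom C x z \<and> b \<in> Hom C x z}"
  (is "_ = ?R")
proof -
  have "(x, zz_class C x x w, x) \<in> ?R" if "zigzag C x w x" for w
    using zigzag_fraction[OF that] unfolding fraction_def by (blast dest: zz_class_eqI)
  moreover have "zigzag C x [Fwd a, Bwd b] x" if "a \<in> Hom C x z" "b \<in> Hom C x z" for a b z
    using that by (rule zigzag_Fwd_Bwd)
  ultimately show ?thesis
    unfolding fundamental_group_def vertex_group_def Hom_enveloping[OF ore_category] fraction_def
    by auto
qed

lemma fraction_eq_iff:
  assumes "a \<in> Hom C x y" "b \<in> Hom C x y" "c \<in> Hom C x z" "d \<in> Hom C x z"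
  shows "fraction C x a b = fraction C x c d \<longleftrightarrow>
    (\<exists>t. \<exists>k\<in>Hom C y t. \<exists>l\<in>Hom C z t. mul C a k = mul C c l \<and> mul C b k = mul C d l)"
proof -
  have "fraction C x a b = fraction C x c d \<longleftrightarrow> zz_eq C x x [Fwd a, Bwd b] [Fwd c, Bwd d]"
    unfolding fraction_def zz_class_def set_eq_iff mem_Collect_eq prod.inject
    using zz_refl[OF zigzag_Fwd_Bwd[OF assms(3,4)]] by (blast intro: zz_sym zz_trans)
  then show ?thesis using zz_eq_fraction_iff[OF assms] by simp
qed

lemma fraction_expand:
  assumes "a \<in> Hom C x y" "b \<in> Hom C x y" "k \<in> Hom C y t"
  shows "fraction C x (mul C a k) (mul C b k) = fraction C x a b"
  unfolding fraction_def using zz_class_eqI[OF zz_eq_expand[OF assms]] by simp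

lemma fraction_mult:
  assumes a: "a \<in> Hom C x y" and b: "b \<in> Hom C x y" and c: "c \<in> Hom C x y"
  shows "fraction C x a b \<otimes>\<^bsub>fundamental_group C x\<^esub> fraction C x b c = fraction C x a c"
proof -
  have "zz_eq C x x [Fwd a, Bwd b, Fwd b, Bwd c] [Fwd a, Bwd c]"
    by (rule zz_eq_relator[OF rel_Bwd_Fwd[OF b], of _ "[Fwd a]" "[Bwd c]"])
      (auto intro: zigzag_Fwd1[OF a] zigzag_Bwd1[OF c])
  from zz_class_eqI[OF this] show ?thesis
    unfolding fundamental_group_def vertex_group_def fraction_def
    by (simp add: mul_enveloping[OF ore_category zigzag_Fwd_Bwd[OF a b] zigzag_Fwd_Bwd[OF b c]])
qed

lemma fraction_self:
  assumes a: "a \<in> Hom C x y"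
  shows "fraction C x a a = \<one>\<^bsub>fundamental_group C x\<^esub>"
  using zz_class_eqI[OF zz_relator_eq[OF ore_category rel_Fwd_Bwd[OF a]]]
  by (simp add: fraction_def fundamental_group_def vertex_group_def enveloping_groupoid_def)

text \<open>Comparing with \<open>b b^-1\<close> yields \<open>a k = b l\<close> and
  \<open>b k = b l\<close>; left cancellation gives \<open>k = l\<close>, and right cancellation
  gives \<open>a = b\<close>.\<close>

lemma fraction_eq_one:
  assumes a: "a \<in> Hom C x y" and b: "b \<in> Hom C x y"
  shows "fraction C x a b = \<one>\<^bsub>fundamental_group C x\<^esub> \<longleftrightarrow> a = b"
proof
  assume "fraction C x a b = \<one>\<^bsub>fundamental_group C x\<^esub>"
  then have "fraction C x a b = fraction C x b b" using fraction_self b by metis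
  then obtain t k l where k: "k \<in> Hom C y t" "l \<in> Hom C y t"
    "mul C a k = mul C b l" "mul C b k = mul C b l"
    using fraction_eq_iff a b by blast
  then have "k = l" using ore_cancel_left b by blast
  with k show "a = b" using ore_cancel_right a b by blast
qed (use fraction_self a in simp)

lemma fraction_carrier:
  "a \<in> Hom C x z \<Longrightarrow> b \<in> Hom C x z \<Longrightarrow> fraction C x a b \<in> carrier (fundamental_group C x)"
  unfolding carrier_fundamental_group by blast

lemma fraction_inv:
  assumes a: "a \<in> Hom C x y" and b: "b \<in> Hom C x y"
  shows "inv\<^bsub>fundamental_group C x\<^esub> (fraction C x a b) = fraction C x b a"
proof -
  have "x \<in> Obj C" using Hom_in_Obj[OF ore_category a] by blast
  then interpret H: group "fundamental_group C x" by (rule group_fundamental_group[OF ore_category])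
  show ?thesis
    by (rule H.inv_equality) (use a b in \<open>simp_all add: fraction_mult fraction_self fraction_carrier\<close>)
qed

end


section \<open>Orders on hom-sets\<close>

text \<open>Each \<open>Hom C x y\<close> is ordered separately: the quotient \<open>b a^-1\<close>
  requires \<open>a\<close> and \<open>b\<close> to have a common source. Right invariance reflects
  that expanding a fraction does not change it.\<close>

definition right_invariant_order ::
  "('o, 'm) category \<Rightarrow> 'o \<Rightarrow> ('m \<Rightarrow> 'm \<Rightarrow> bool) \<Rightarrow> bool" where
  "right_invariant_order C x r \<longleftrightarrow>
     (\<forall>y. irreflp_on (Hom C x y) r \<and> transp_on (Hom C x y) r \<and> totalp_on (Hom C x y) r) \<and>
     (\<forall>y z. \<forall>a\<in>Hom C x y. \<forall>b\<in>Hom C x y. \<forall>k\<in>Hom C y z.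
        r a b \<longrightarrow> r (mul C a k) (mul C b k))"

text \<open>In terms of fractions: \<open>a < b\<close> implies \<open>d < d (a\<inverse> b)\<close>, where \<open>a\<inverse> b = k l\<inverse>\<close>.\<close>

definition conjugation_invariant_order ::
  "('o, 'm) category \<Rightarrow> 'o \<Rightarrow> ('m \<Rightarrow> 'm \<Rightarrow> bool) \<Rightarrow> bool" where
  "conjugation_invariant_order C x r \<longleftrightarrow>
     (\<forall>y z. \<forall>a\<in>Hom C x y. \<forall>b\<in>Hom C x y. \<forall>d\<in>Hom C x y. \<forall>k\<in>Hom C y z. \<forall>l\<in>Hom C y z.
        r a b \<longrightarrow> mul C a k = mul C b l \<longrightarrow> r (mul C d l) (mul C d k))"

context
  fixes C :: "('o, 'm) category" and x :: 'o
  assumes ore: "right_ore C" and x: "x \<in> Obj C"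
begin

interpretation category C by (rule ore_category[OF ore])

interpretation H: group "fundamental_group C x"
  by (rule group_fundamental_group[OF ore_category[OF ore] x])

context
  fixes r
  assumes r: "right_invariant_order C x r"
begin

lemma right_invariant_irrefl: "a \<in> Hom C x y \<Longrightarrow> \<not> r a a"
  using r unfolding right_invariant_order_def by (auto dest: irreflp_onD)

lemma right_invariant_trans:
  "a \<in> Hom C x y \<Longrightarrow> b \<in> Hom C x y \<Longrightarrow> c \<in> Hom C x y \<Longrightarrow> r a b \<Longrightarrow> r b c \<Longrightarrow> r a c"
  using r unfolding right_invariant_order_def by (blast dest: transp_onD)

lemma right_invariant_total: "a \<in> Hom C x y \<Longrightarrow> b \<in> Hom C x y \<Longrightarrow> a \<noteq> b \<Longrightarrow> r a b \<or> r b a"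
  using r unfolding right_invariant_order_def by (blast dest: totalp_onD)

lemma right_invariant_mul:
  "a \<in> Hom C x y \<Longrightarrow> b \<in> Hom C x y \<Longrightarrow> k \<in> Hom C y z \<Longrightarrow> r a b \<Longrightarrow> r (mul C a k) (mul C b k)"
  using r unfolding right_invariant_order_def by blast

end

definition fraction_cone :: "('m \<Rightarrow> 'm \<Rightarrow> bool) \<Rightarrow> ('o \<times> 'm letter list set \<times> 'o) set" where
  "fraction_cone r = {fraction C x b a |a b y. a \<in> Hom C x y \<and> b \<in> Hom C x y \<and> r a b}"

lemma fraction_cone_subset: "fraction_cone r \<subseteq> carrier (fundamental_group C x)"
  unfolding fraction_cone_def using fraction_carrier[OF ore] by blast

text \<open>For \<open>b a^-1\<close> and \<open>d c^-1\<close> choose \<open>a k = d l\<close>. The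
  product is then \<open>(b k) (c l)^-1\<close>, and invariance places \<open>c l\<close> below
  \<open>d l = a k\<close>, which lies below \<open>b k\<close>.\<close>

lemma fraction_cone_mult:
  assumes r: "right_invariant_order C x r" and "p \<in> fraction_cone r" "q \<in> fraction_cone r"
  shows "p \<otimes>\<^bsub>fundamental_group C x\<^esub> q \<in> fraction_cone r"
proof -
  obtain a b y where p: "p = fraction C x b a" "a \<in> Hom C x y" "b \<in> Hom C x y" "r a b"
    using assms unfolding fraction_cone_def by blast
  obtain c d z where q: "q = fraction C x d c" "c \<in> Hom C x z" "d \<in> Hom C x z" "r c d"
    using assms unfolding fraction_cone_def by blast
  obtain t k l where k: "k \<in> Hom C y t" and l: "l \<in> Hom C z t" and eq: "mul C a k = mul C d l"
    using ore_common_multiple[OF ore p(2) q(3)] by metis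
  have h: "mul C a k \<in> Hom C x t" "mul C b k \<in> Hom C x t" "mul C c l \<in> Hom C x t"
    using mul_in_Hom k l p q by blast+
  have "p = fraction C x (mul C b k) (mul C a k)" "q = fraction C x (mul C a k) (mul C c l)"
    unfolding p(1) q(1) using fraction_expand[OF ore p(3,2) k] fraction_expand[OF ore q(3,2) l] eq
    by simp_all
  then have "p \<otimes>\<^bsub>fundamental_group C x\<^esub> q = fraction C x (mul C b k) (mul C c l)"
    using fraction_mult[OF ore] h by simp
  moreover have "r (mul C c l) (mul C b k)"
    using right_invariant_trans[OF r h(3,1,2)] right_invariant_mul[OF r p(2,3) k p(4)]
      right_invariant_mul[OF r q(2,3) l q(4)] eq by simp
  ultimately show ?thesis unfolding fraction_cone_def using h by blast
qed

lemma fraction_cone_one: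
  assumes r: "right_invariant_order C x r"
  shows "\<one>\<^bsub>fundamental_group C x\<^esub> \<notin> fraction_cone r"
proof
  assume "\<one>\<^bsub>fundamental_group C x\<^esub> \<in> fraction_cone r"
  then obtain a b y where "\<one>\<^bsub>fundamental_group C x\<^esub> = fraction C x b a"
    "a \<in> Hom C x y" "b \<in> Hom C x y" "r a b"
    unfolding fraction_cone_def by blast
  then show False using fraction_eq_one[OF ore] right_invariant_irrefl[OF r] by metis
qed

lemma fraction_cone_total:
  assumes r: "right_invariant_order C x r" and p: "p \<in> carrier (fundamental_group C x)"
  shows "p = \<one>\<^bsub>fundamental_group C x\<^esub> \<or> p \<in> fraction_cone r \<or>
    inv\<^bsub>fundamental_group C x\<^esub> p \<in> fraction_cone r"
proof -
  obtain a b y where ab: "p = fraction C x a b" "a \<in> Hom C x y" "b \<in> Hom C x y"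
    using p unfolding carrier_fundamental_group[OF ore] by blast
  show ?thesis
  proof (cases "a = b")
    case True
    then show ?thesis using ab fraction_self[OF ore] by simp
  next
    case False
    then have "r a b \<or> r b a" using right_invariant_total[OF r] ab by blast
    then show ?thesis
      using ab fraction_inv[OF ore] unfolding fraction_cone_def by auto
  qed
qed

text \<open>The fractions are expanded until neighbouring factors of \<open>u^-1 p u\<close> share a
  morphism; positivity of what remains is exactly the conclusion of
  \<open>conjugation_invariant_order\<close>.\<close>

lemma fraction_cone_conj:
  assumes r: "right_invariant_order C x r" and conj: "conjugation_invariant_order C x r"
    and "p \<in> fraction_cone r" and u: "u \<in> carrier (fundamental_group C x)"
  shows "inv\<^bsub>fundamental_group C x\<^esub> u \<otimes>\<^bsub>fundamental_group C x\<^esub> p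
    \<otimes>\<^bsub>fundamental_group C x\<^esub> u \<in> fraction_cone r"
proof -
  obtain a b y where p: "p = fraction C x b a" "a \<in> Hom C x y" "b \<in> Hom C x y" "r a b"
    using assms unfolding fraction_cone_def by blast
  obtain c d z where u': "u = fraction C x c d" "c \<in> Hom C x z" "d \<in> Hom C x z"
    using u unfolding carrier_fundamental_group[OF ore] by blast
  obtain t m n where m: "m \<in> Hom C y t" and n: "n \<in> Hom C z t" and eq: "mul C a m = mul C c n"
    using ore_common_multiple[OF ore p(2) u'(2)] by metis
  define a' b' d' where "a' = mul C a m" and "b' = mul C b m" and "d' = mul C d n"
  have h: "a' \<in> Hom C x t" "b' \<in> Hom C x t" "d' \<in> Hom C x t"
    unfolding a'_def b'_def d'_def using mul_in_Hom m n p u' by blast+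
  have p': "p = fraction C x b' a'" and u'': "u = fraction C x a' d'"
    unfolding p(1) u'(1) a'_def b'_def d'_def
    using fraction_expand[OF ore p(3,2) m] fraction_expand[OF ore u'(2,3) n] eq by simp_all
  have r': "r a' b'" unfolding a'_def b'_def using right_invariant_mul[OF r p(2,3) m p(4)] .
  \<comment> \<open>With this choice \<open>p = (a' k) (a' l)^-1\<close>, so in
    \<open>u^-1 p u\<close> both \<open>a' k\<close> and \<open>a' l\<close> cancel and
    \<open>(d' k) (d' l)^-1\<close> is left.\<close>
  obtain s k l where k: "k \<in> Hom C t s" and l: "l \<in> Hom C t s" and kl: "mul C a' k = mul C b' l"
    using ore_common_multiple[OF ore h(1,2)] by metis
  have h': "mul C a' k \<in> Hom C x s" "mul C a' l \<in> Hom C x s" "mul C d' k \<in> Hom C x s"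
    "mul C d' l \<in> Hom C x s"
    using mul_in_Hom k l h by blast+
  have iu: "inv\<^bsub>fundamental_group C x\<^esub> u = fraction C x (mul C d' k) (mul C a' k)"
    and p'': "p = fraction C x (mul C a' k) (mul C a' l)"
    and u''': "u = fraction C x (mul C a' l) (mul C d' l)"
    unfolding p' u'' fraction_inv[OF ore h(1,3)]
    using fraction_expand[OF ore h(3,1) k] fraction_expand[OF ore h(2,1) l]
      fraction_expand[OF ore h(1,3) l] kl by simp_all
  have "inv\<^bsub>fundamental_group C x\<^esub> u \<otimes>\<^bsub>fundamental_group C x\<^esub> p
    \<otimes>\<^bsub>fundamental_group C x\<^esub> u = fraction C x (mul C d' k) (mul C d' l)"
    unfolding iu unfolding p'' unfolding u''' using fraction_mult[OF ore] h' by simp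
  moreover have "r (mul C d' l) (mul C d' k)"
    using conj h k l kl r' unfolding conjugation_invariant_order_def by blast
  ultimately show ?thesis unfolding fraction_cone_def using h' by auto
qed

text \<open>Right invariance is automatic, since the two fractions to be compared with
  \<open>\<one>\<close> are equal by expansion. The order axioms come from the positive elements of
  the group.\<close>

lemma right_invariant_order_of_left_ordering:
  assumes r: "left_ordering (fundamental_group C x) r"
  shows "right_invariant_order C x (\<lambda>a b. r \<one>\<^bsub>fundamental_group C x\<^esub> (fraction C x b a))"
  unfolding right_invariant_order_def
proof (intro conjI allI ballI impI)
  fix y
  show "irreflp_on (Hom C x y) (\<lambda>a b. r \<one>\<^bsub>fundamental_group C x\<^esub> (fraction C x b a))"
    using fraction_self[OF ore] H.left_ordering_irrefl[OF r H.one_closed]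
    by (auto intro!: irreflp_onI)
  show "transp_on (Hom C x y) (\<lambda>a b. r \<one>\<^bsub>fundamental_group C x\<^esub> (fraction C x b a))"
  proof (rule transp_onI)
    fix a b c
    assume h: "a \<in> Hom C x y" "b \<in> Hom C x y" "c \<in> Hom C x y"
      "r \<one>\<^bsub>fundamental_group C x\<^esub> (fraction C x b a)"
      "r \<one>\<^bsub>fundamental_group C x\<^esub> (fraction C x c b)"
    have "r \<one>\<^bsub>fundamental_group C x\<^esub>
        (fraction C x c b \<otimes>\<^bsub>fundamental_group C x\<^esub> fraction C x b a)"
      by (rule H.left_ordering_pos_mult[OF r]) (use h fraction_carrier[OF ore] in auto)
    then show "r \<one>\<^bsub>fundamental_group C x\<^esub> (fraction C x c a)"
      using fraction_mult[OF ore] h by simp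
  qed
  show "totalp_on (Hom C x y) (\<lambda>a b. r \<one>\<^bsub>fundamental_group C x\<^esub> (fraction C x b a))"
  proof (rule totalp_onI)
    fix a b
    assume h: "a \<in> Hom C x y" "b \<in> Hom C x y" "a \<noteq> b"
    then show "r \<one>\<^bsub>fundamental_group C x\<^esub> (fraction C x b a) \<or>
        r \<one>\<^bsub>fundamental_group C x\<^esub> (fraction C x a b)"
      using H.left_ordering_pos_total[OF r, of "fraction C x b a"] fraction_eq_one[OF ore]
        fraction_inv[OF ore] fraction_carrier[OF ore] by metis
  qed
next
  fix y z a b k
  assume "a \<in> Hom C x y" "b \<in> Hom C x y" "k \<in> Hom C y z"
    "r \<one>\<^bsub>fundamental_group C x\<^esub> (fraction C x b a)"
  then show "r \<one>\<^bsub>fundamental_group C x\<^esub> (fraction C x (mul C b k) (mul C a k))"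
    using fraction_expand[OF ore] by simp
qed

text \<open>If \<open>a k = b l\<close>, then \<open>(d k) (d l)^-1\<close> is the conjugate of
  \<open>b a^-1\<close> by \<open>d a^-1\<close>.\<close>

lemma conjugation_invariant_order_of_bi_ordering:
  assumes r: "bi_ordering (fundamental_group C x) r"
  shows "conjugation_invariant_order C x
    (\<lambda>a b. r \<one>\<^bsub>fundamental_group C x\<^esub> (fraction C x b a))"
  unfolding conjugation_invariant_order_def
proof (intro allI ballI impI)
  fix y z a b d k l
  assume h: "a \<in> Hom C x y" "b \<in> Hom C x y" "d \<in> Hom C x y" and k: "k \<in> Hom C y z"
    and l: "l \<in> Hom C y z" and eq: "mul C a k = mul C b l"
    and pos: "r \<one>\<^bsub>fundamental_group C x\<^esub> (fraction C x b a)"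
  have h': "mul C a k \<in> Hom C x z" "mul C a l \<in> Hom C x z" "mul C d k \<in> Hom C x z"
    "mul C d l \<in> Hom C x z"
    using mul_in_Hom k l h by blast+
  have da: "fraction C x d a = fraction C x (mul C d k) (mul C a k)"
    and ba: "fraction C x b a = fraction C x (mul C a k) (mul C a l)"
    and ad: "fraction C x a d = fraction C x (mul C a l) (mul C d l)"
    using fraction_expand[OF ore h(3,1) k] fraction_expand[OF ore h(2,1) l]
      fraction_expand[OF ore h(1,3) l] eq by simp_all
  have "fraction C x d a \<otimes>\<^bsub>fundamental_group C x\<^esub> fraction C x b a
      \<otimes>\<^bsub>fundamental_group C x\<^esub> fraction C x a d = fraction C x (mul C d k) (mul C d l)"
    unfolding da ba ad using fraction_mult[OF ore] h' by simp
  moreover have "r \<one>\<^bsub>fundamental_group C x\<^esub>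
     (fraction C x d a \<otimes>\<^bsub>fundamental_group C x\<^esub> fraction C x b a
      \<otimes>\<^bsub>fundamental_group C x\<^esub> inv\<^bsub>fundamental_group C x\<^esub> fraction C x d a)"
    by (rule H.bi_ordering_pos_conj[OF r]) (use h pos fraction_carrier[OF ore] in auto)
  ultimately show "r \<one>\<^bsub>fundamental_group C x\<^esub> (fraction C x (mul C d k) (mul C d l))"
    using fraction_inv[OF ore] h by simp
qed

text \<open>This moves the problem from the group to hom-sets, where morphisms of an indirect
  product can be factored.\<close>

theorem left_orderable_fundamental_group_iff:
  "left_orderable (fundamental_group C x) \<longleftrightarrow> (\<exists>r. right_invariant_order C x r)"
proof
  assume "left_orderable (fundamental_group C x)"
  then show "\<exists>r. right_invariant_order C x r"
    unfolding left_orderable_def using right_invariant_order_of_left_ordering by blast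
next
  assume "\<exists>r. right_invariant_order C x r"
  then obtain r where r: "right_invariant_order C x r" ..
  show "left_orderable (fundamental_group C x)"
    unfolding left_orderable_def
    using H.left_ordering_of_cone[OF fraction_cone_subset fraction_cone_mult[OF r]
        fraction_cone_one[OF r] fraction_cone_total[OF r]] H.is_group by blast
qed

theorem bi_orderable_fundamental_group_iff:
  "bi_orderable (fundamental_group C x) \<longleftrightarrow>
    (\<exists>r. right_invariant_order C x r \<and> conjugation_invariant_order C x r)"
proof
  assume "bi_orderable (fundamental_group C x)"
  then obtain r where "bi_ordering (fundamental_group C x) r" unfolding bi_orderable_def by blast
  then show "\<exists>r. right_invariant_order C x r \<and> conjugation_invariant_order C x r"
    using right_invariant_order_of_left_ordering conjugation_invariant_order_of_bi_ordering
    unfolding bi_ordering_def by meson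
next
  assume "\<exists>r. right_invariant_order C x r \<and> conjugation_invariant_order C x r"
  then obtain r where r: "right_invariant_order C x r" "conjugation_invariant_order C x r" by blast
  show "bi_orderable (fundamental_group C x)"
    unfolding bi_orderable_def
    using H.bi_ordering_of_cone[OF fraction_cone_subset fraction_cone_mult[OF r(1)]
        fraction_cone_one[OF r(1)] fraction_cone_total[OF r(1)] fraction_cone_conj[OF r]]
      H.is_group by blast
qed

end


section \<open>Indirect products\<close>

lemma wide_Obj: "wide_subcategory S C \<Longrightarrow> Obj S = Obj C"
  unfolding wide_subcategory_def by blast

lemma wide_Hom: "wide_subcategory S C \<Longrightarrow> a \<in> Hom S x y \<Longrightarrow> a \<in> Hom C x y"
  unfolding wide_subcategory_def Hom_def by auto

lemma wide_Hom_iff: "wide_subcategory S C \<Longrightarrow> a \<in> Hom S x y \<longleftrightarrow> a \<in> Arr S \<and> a \<in> Hom C x y"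
  unfolding wide_subcategory_def Hom_def by auto

lemma wide_mul:
  "wide_subcategory S C \<Longrightarrow> a \<in> Hom S x y \<Longrightarrow> b \<in> Hom S y z \<Longrightarrow> mul S a b = mul C a b"
  unfolding wide_subcategory_def Hom_def by auto

lemma wide_mul_in_Hom:
  assumes "wide_subcategory S C" "a \<in> Hom S x y" "b \<in> Hom S y z"
  shows "mul C a b \<in> Hom S x z"
proof -
  have "category S" using assms(1) unfolding wide_subcategory_def by blast
  from category.mul_in_Hom[OF this assms(2,3)] show ?thesis unfolding wide_mul[OF assms] .
qed

lemma wide_ident_in_Hom:
  assumes "wide_subcategory S C" "x \<in> Obj C"
  shows "ident C x \<in> Hom S x x"
  using assms category.ident_in_Hom[of S x] unfolding wide_subcategory_def by simp

section \<open>Unique factorization and exchange in an indirect product\<close>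

locale ore_indirect_product =
  fixes C F G :: "('o, 'm) category"
  assumes product: "indirect_product C F G" and ore: "right_ore C" and groupoid_G: "groupoid G"
begin

abbreviation comp (infixl \<open>\<cdot>\<close> 70) where "a \<cdot> b \<equiv> mul C a b"

sublocale category C by (rule ore_category[OF ore])

lemma wide_F: "wide_subcategory F C" and wide_G: "wide_subcategory G C"
  using product unfolding indirect_product_def by blast+

lemmas F_Hom = wide_Hom[OF wide_F] and G_Hom = wide_Hom[OF wide_G]
lemmas F_mul = wide_mul_in_Hom[OF wide_F] and G_mul = wide_mul_in_Hom[OF wide_G]
lemmas Hom_Obj = Hom_in_Obj[OF ore_category[OF ore]]

definition factors :: "'m \<Rightarrow> 'm \<times> 'm" where
  "factors a = (THE p. fst p \<in> Arr F \<and> snd p \<in> Arr G \<and> src C (fst p) = tgt C (snd p) \<and>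
     a = fst p \<cdot> snd p)"

definition F_part :: "'m \<Rightarrow> 'm" where "F_part a = fst (factors a)"

definition G_part :: "'m \<Rightarrow> 'm" where "G_part a = snd (factors a)"

lemma act_on_eq: "act_on C F G g f = F_part (g \<cdot> f)"
  and act_exp_eq: "act_exp C F G g f = G_part (g \<cdot> f)"
  unfolding act_on_def act_exp_def exchange_def F_part_def G_part_def factors_def by (rule refl)+

lemma parts_mul:
  assumes f: "f \<in> Hom F x y" and g: "g \<in> Hom G y z"
  shows "F_part (f \<cdot> g) = f" "G_part (f \<cdot> g) = g"
proof -
  have "f \<cdot> g \<in> Arr C" using mul_in_Hom[OF F_Hom[OF f] G_Hom[OF g]] by (simp add: Hom_def)
  with product have "\<exists>!p. fst p \<in> Arr F \<and> snd p \<in> Arr G \<and> src C (fst p) = tgt C (snd p) \<and>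
      f \<cdot> g = fst p \<cdot> snd p"
    unfolding indirect_product_def by blast
  moreover have "f \<in> Arr F" "g \<in> Arr G" "src C f = tgt C g"
    using f g F_Hom[OF f] G_Hom[OF g] by (simp_all add: Hom_def)
  ultimately have "factors (f \<cdot> g) = (f, g)" unfolding factors_def by (intro the1_equality) simp_all
  then show "F_part (f \<cdot> g) = f" "G_part (f \<cdot> g) = g" by (simp_all add: F_part_def G_part_def)
qed

lemma factorize:
  assumes "a \<in> Hom C x z"
  obtains y where "F_part a \<in> Hom F x y" "G_part a \<in> Hom G y z" "a = F_part a \<cdot> G_part a"
proof -
  have "a \<in> Arr C" using assms by (simp add: Hom_def)
  with product obtain p where p: "fst p \<in> Arr F" "snd p \<in> Arr G" "src C (fst p) = tgt C (snd p)"
    "a = fst p \<cdot> snd p"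
    unfolding indirect_product_def by meson
  then have arr: "fst p \<in> Arr C" "snd p \<in> Arr C"
    using wide_F wide_G unfolding wide_subcategory_def by blast+
  then have "fst p \<cdot> snd p \<in> Hom C (tgt C (fst p)) (src C (snd p))"
    using mul_in_Hom p(3) by (simp add: Hom_def)
  with p(4) assms have e: "tgt C (fst p) = x" "src C (snd p) = z" by (simp_all add: Hom_def)
  have f: "fst p \<in> Hom F x (tgt C (snd p))" and g: "snd p \<in> Hom G (tgt C (snd p)) z"
    using p(1-3) arr e unfolding wide_Hom_iff[OF wide_F] wide_Hom_iff[OF wide_G]
    by (simp_all add: Hom_def)
  from parts_mul[OF f g] have "F_part a = fst p" "G_part a = snd p" unfolding p(4) by simp_all
  with that f g p(4) show thesis by metis
qed

lemma factor_unique: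
  assumes "f \<in> Hom F x y" "g \<in> Hom G y z" "f' \<in> Hom F x y'" "g' \<in> Hom G y' z"
    and "f \<cdot> g = f' \<cdot> g'"
  shows "f = f'" "g = g'"
  using parts_mul[OF assms(1,2)] parts_mul[OF assms(3,4)] assms(5) by simp_all

lemma parts_mul_mul:
  assumes f: "f \<in> Hom F x y" and g: "g \<in> Hom G y z" and k: "k \<in> Hom F z w" and l: "l \<in> Hom G w v"
  shows "F_part (f \<cdot> g \<cdot> (k \<cdot> l)) = f \<cdot> F_part (g \<cdot> k)"
    and "G_part (f \<cdot> g \<cdot> (k \<cdot> l)) = G_part (g \<cdot> k) \<cdot> l"
proof -
  have "g \<cdot> k \<in> Hom C y w" by (rule mul_in_Hom[OF G_Hom[OF g] F_Hom[OF k]])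
  then obtain u where u: "F_part (g \<cdot> k) \<in> Hom F y u" "G_part (g \<cdot> k) \<in> Hom G u w"
    "g \<cdot> k = F_part (g \<cdot> k) \<cdot> G_part (g \<cdot> k)"
    by (rule factorize)
  have "f \<cdot> g \<cdot> (k \<cdot> l) = f \<cdot> (g \<cdot> k \<cdot> l)"
    using mul_assoc[OF F_Hom[OF f] G_Hom[OF g] mul_in_Hom[OF F_Hom[OF k] G_Hom[OF l]]]
      mul_assoc[OF G_Hom[OF g] F_Hom[OF k] G_Hom[OF l]] by simp
  also have "\<dots> = f \<cdot> (F_part (g \<cdot> k) \<cdot> (G_part (g \<cdot> k) \<cdot> l))"
    using mul_assoc[OF F_Hom[OF u(1)] G_Hom[OF u(2)] G_Hom[OF l]] u(3) by simp
  also have "\<dots> = f \<cdot> F_part (g \<cdot> k) \<cdot> (G_part (g \<cdot> k) \<cdot> l)"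
    by (rule mul_assoc[OF F_Hom[OF f] F_Hom[OF u(1)] G_Hom[OF G_mul[OF u(2) l]], symmetric])
  finally show "F_part (f \<cdot> g \<cdot> (k \<cdot> l)) = f \<cdot> F_part (g \<cdot> k)"
    "G_part (f \<cdot> g \<cdot> (k \<cdot> l)) = G_part (g \<cdot> k) \<cdot> l"
    using parts_mul[OF F_mul[OF f u(1)] G_mul[OF u(2) l]] by simp_all
qed

text \<open>The cocycle rule for \<open>g^f\<close>: moving \<open>f\<close> past
  \<open>p \<cdot> g\<close> means moving it past \<open>g\<close> and then moving the resulting
  \<open>F\<close>-part past \<open>p\<close>.\<close>

lemma G_part_exchange:
  assumes p: "p \<in> Hom G w x" and g: "g \<in> Hom G x y" and f: "f \<in> Hom F y z"
  shows "G_part (p \<cdot> g \<cdot> f) = G_part (p \<cdot> F_part (g \<cdot> f)) \<cdot> G_part (g \<cdot> f)"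
proof -
  obtain u where u: "F_part (g \<cdot> f) \<in> Hom F x u" "G_part (g \<cdot> f) \<in> Hom G u z"
    "g \<cdot> f = F_part (g \<cdot> f) \<cdot> G_part (g \<cdot> f)"
    using factorize[OF mul_in_Hom[OF G_Hom[OF g] F_Hom[OF f]]] .
  obtain v where v: "F_part (p \<cdot> F_part (g \<cdot> f)) \<in> Hom F w v" "G_part (p \<cdot> F_part (g \<cdot> f)) \<in> Hom G v u"
    "p \<cdot> F_part (g \<cdot> f) = F_part (p \<cdot> F_part (g \<cdot> f)) \<cdot> G_part (p \<cdot> F_part (g \<cdot> f))"
    using factorize[OF mul_in_Hom[OF G_Hom[OF p] F_Hom[OF u(1)]]] .
  have "p \<cdot> g \<cdot> f = p \<cdot> (g \<cdot> f)" by (rule mul_assoc[OF G_Hom[OF p] G_Hom[OF g] F_Hom[OF f]])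
  also have "\<dots> = p \<cdot> F_part (g \<cdot> f) \<cdot> G_part (g \<cdot> f)"
    using mul_assoc[OF G_Hom[OF p] F_Hom[OF u(1)] G_Hom[OF u(2)]] u(3) by simp
  also have "\<dots> = F_part (p \<cdot> F_part (g \<cdot> f)) \<cdot> (G_part (p \<cdot> F_part (g \<cdot> f)) \<cdot> G_part (g \<cdot> f))"
    using mul_assoc[OF F_Hom[OF v(1)] G_Hom[OF v(2)] G_Hom[OF u(2)]] v(3) by simp
  finally show ?thesis using parts_mul(2)[OF v(1) G_mul[OF v(2) u(2)]] by simp
qed

lemma G_part_eq_F_part_Hom:
  assumes "a \<in> Hom C x z" "b \<in> Hom C x z" "G_part a = G_part b"
  obtains y where "F_part a \<in> Hom F x y" "F_part b \<in> Hom F x y"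
proof -
  obtain y where y: "F_part a \<in> Hom F x y" "G_part a \<in> Hom G y z" using factorize[OF assms(1)] .
  obtain y' where y': "F_part b \<in> Hom F x y'" "G_part b \<in> Hom G y' z" using factorize[OF assms(2)] .
  have "y = y'" using y(2) y'(2) assms(3) by (simp add: Hom_def)
  with y y' that show thesis by blast
qed

text \<open>Cancellation is inherited from \<open>C\<close>. For common multiples, take them in
  \<open>C\<close> and keep only the \<open>F\<close>-parts of the two cofactors.\<close>

lemma right_ore_F: "right_ore F"
  unfolding right_ore_def
proof (intro conjI ballI impI)
  show "category F" using wide_F unfolding wide_subcategory_def by blast
  have F: "tgt F a = tgt C a" "src F a = src C a" "a \<in> Arr C" if "a \<in> Arr F" for a
    using that wide_F unfolding wide_subcategory_def by auto
  have mul: "mul F a b = a \<cdot> b" if "a \<in> Arr F" "b \<in> Arr F" "src C a = tgt C b" for a b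
    using that wide_F F unfolding wide_subcategory_def by auto
  have Hom: "a \<in> Hom F (tgt C a) (src C a)" if "a \<in> Arr F" for a
    using that by (simp add: Hom_def F)
  have "b = c" if "a \<in> Arr F" "b \<in> Arr F" "c \<in> Arr F" "src C a = tgt C b" "src C a = tgt C c"
    "a \<cdot> b = a \<cdot> c" for a b c
    using that ore_cancel_left[OF ore, of a "tgt C a" "src C a" b "src C b" c "src C c"]
      Hom[THEN F_Hom] by metis
  moreover have "a = c" if "a \<in> Arr F" "b \<in> Arr F" "c \<in> Arr F" "src C a = tgt C b"
    "src C c = tgt C b" "a \<cdot> b = c \<cdot> b" for a b c
    using that ore_cancel_right[OF ore, of a "tgt C a" "src C a" c "tgt C c" b "src C b"]
      Hom[THEN F_Hom] by metis
  ultimately show "cancellative F" unfolding cancellative_def by (metis F(1,2) mul)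
  fix a b assume ab: "a \<in> Arr F" "b \<in> Arr F" "tgt F a = tgt F b"
  then have a: "a \<in> Hom F (tgt C a) (src C a)" and b: "b \<in> Hom F (tgt C a) (src C b)"
    by (simp_all add: Hom_def F)
  obtain t k l where k: "k \<in> Hom C (src C a) t" and l: "l \<in> Hom C (src C b) t"
    and eq: "a \<cdot> k = b \<cdot> l"
    using ore_common_multiple[OF ore F_Hom[OF a] F_Hom[OF b]] by metis
  obtain u where u: "F_part k \<in> Hom F (src C a) u" "G_part k \<in> Hom G u t"
    "k = F_part k \<cdot> G_part k" using factorize[OF k] .
  obtain v where v: "F_part l \<in> Hom F (src C b) v" "G_part l \<in> Hom G v t"
    "l = F_part l \<cdot> G_part l" using factorize[OF l] .
  have "a \<cdot> F_part k \<cdot> G_part k = a \<cdot> k" "b \<cdot> F_part l \<cdot> G_part l = b \<cdot> l"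
    using mul_assoc[OF F_Hom[OF a] F_Hom[OF u(1)] G_Hom[OF u(2)]]
      mul_assoc[OF F_Hom[OF b] F_Hom[OF v(1)] G_Hom[OF v(2)]] u(3) v(3) by simp_all
  \<comment> \<open>Both sides of \<open>a \<cdot> k = b \<cdot> l\<close> are now factored, so
    uniqueness equates their \<open>F\<close>-parts.\<close>
  then have "a \<cdot> F_part k = b \<cdot> F_part l"
    using factor_unique(1)[OF F_mul[OF a u(1)] u(2) F_mul[OF b v(1)] v(2)] eq by simp
  then show "\<exists>b1\<in>Arr F. \<exists>b2\<in>Arr F. src F a = tgt F b1 \<and> src F b = tgt F b2 \<and>
      mul F a b1 = mul F b b2"
    using u(1) v(1) F[of a] F[of b] ab
    by (intro bexI[of _ "F_part k"] bexI[of _ "F_part l"]) (auto simp: Hom_def F mul)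
qed

lemma G_inverse:
  assumes g: "g \<in> Hom G x y"
  obtains h where "h \<in> Hom G y x" "g \<cdot> h = ident C x" "h \<cdot> g = ident C y"
proof -
  have gA: "g \<in> Arr G" "tgt G g = x" "src G g = y" using g by (auto simp: Hom_def)
  then obtain h where h: "inverse_pair G g h" using groupoid.invertible[OF groupoid_G] by blast
  then have "h \<in> Hom G y x" using gA unfolding inverse_pair_def by simp
  moreover have "ident G x = ident C x" "ident G y = ident C y"
    using Hom_Obj[OF G_Hom[OF g]] wide_G unfolding wide_subcategory_def by auto
  ultimately show thesis
    using that[of h] h gA wide_mul[OF wide_G g] wide_mul[OF wide_G _ g]
    unfolding inverse_pair_def by metis
qed

end

text \<open>These are the properties of a positive cone used for the order, freed from
  \<open>\<Phi>\<close> and its target. A single set \<open>P\<close> collects the positive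
  morphisms of all components, and \<open>cone_exchange\<close> is compatibility with
  \<open>F\<close>.\<close>

locale exchange_positive_cone = ore_indirect_product +
  fixes P :: "'b set"
  assumes cone_Arr: "p \<in> P \<Longrightarrow> p \<in> Arr G"
    and cone_ident: "x \<in> Obj C \<Longrightarrow> ident C x \<notin> P"
    and cone_mul: "p \<in> P \<Longrightarrow> q \<in> P \<Longrightarrow> p \<in> Hom G x y \<Longrightarrow> q \<in> Hom G y z \<Longrightarrow> p \<cdot> q \<in> P"
    and cone_total: "g \<in> Hom G x y \<Longrightarrow> h \<in> Hom G y x \<Longrightarrow> g \<cdot> h = ident C x \<Longrightarrow>
      h \<cdot> g = ident C y \<Longrightarrow> g = ident C x \<or> g \<in> P \<or> h \<in> P"
    and cone_exchange: "p \<in> P \<Longrightarrow> p \<in> Hom G x y \<Longrightarrow> f \<in> Hom F y z \<Longrightarrow> G_part (p \<cdot> f) \<in> P"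
begin

text \<open>This encodes \<open>h g^-1 \<in> P\<close> without inverses. The morphisms
  \<open>g\<close> and \<open>h\<close> have the same source but possibly different targets.\<close>

definition cone_less :: "'b \<Rightarrow> 'b \<Rightarrow> bool" where
  "cone_less g h \<longleftrightarrow> (\<exists>p\<in>P. src C p = tgt C g \<and> h = p \<cdot> g)"

lemma cone_lessE:
  assumes "cone_less g h" "g \<in> Hom G x z"
  obtains p y where "p \<in> P" "p \<in> Hom G y x" "h = p \<cdot> g"
proof -
  obtain p where p: "p \<in> P" "src C p = tgt C g" "h = p \<cdot> g"
    using assms(1) unfolding cone_less_def by blast
  have "tgt C g = x" using G_Hom[OF assms(2)] by (simp add: Hom_def)
  moreover have "p \<in> Arr C" using wide_G cone_Arr[OF p(1)] unfolding wide_subcategory_def by blast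
  ultimately have "p \<in> Hom G (tgt C p) x"
    unfolding wide_Hom_iff[OF wide_G] using cone_Arr[OF p(1)] p(2) by (simp add: Hom_def)
  with p that show thesis by blast
qed

lemma cone_lessI: "p \<in> P \<Longrightarrow> p \<in> Hom G y x \<Longrightarrow> g \<in> Hom G x z \<Longrightarrow> cone_less g (p \<cdot> g)"
  unfolding cone_less_def using G_Hom[of p] G_Hom[of g] by (auto simp: Hom_def)

lemma cone_less_irrefl: "g \<in> Hom G x z \<Longrightarrow> \<not> cone_less g g"
proof
  assume g: "g \<in> Hom G x z" and less: "cone_less g g"
  obtain p y where p: "p \<in> P" "p \<in> Hom G y x" "g = p \<cdot> g" using cone_lessE[OF less g] .
  have "p \<cdot> g \<in> Hom C y z" by (rule mul_in_Hom[OF G_Hom[OF p(2)] G_Hom[OF g]])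
  with p(3) G_Hom[OF g] have "y = x" by (simp add: Hom_def)
  have x: "x \<in> Obj C" using Hom_Obj[OF G_Hom[OF g]] by blast
  have "p \<cdot> g = ident C x \<cdot> g" using p(3) mul_ident_left[OF G_Hom[OF g]] by simp
  then have "p = ident C x"
    using ore_cancel_right[OF ore G_Hom[OF p(2)] ident_in_Hom[OF x] G_Hom[OF g]] by blast
  with p(1) cone_ident[OF x] show False by simp
qed

lemma cone_less_trans:
  assumes g: "g \<in> Hom G x z" and "cone_less g h" "cone_less h i"
  shows "cone_less g i"
proof -
  obtain p y where p: "p \<in> P" "p \<in> Hom G y x" "h = p \<cdot> g" using cone_lessE[OF assms(2,1)] .
  have h: "h \<in> Hom G y z" unfolding p(3) by (rule G_mul[OF p(2) g])
  obtain q w where q: "q \<in> P" "q \<in> Hom G w y" "i = q \<cdot> h" using cone_lessE[OF assms(3) h] .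
  have "i = q \<cdot> p \<cdot> g"
    unfolding q(3) p(3) by (rule mul_assoc[OF G_Hom[OF q(2)] G_Hom[OF p(2)] G_Hom[OF g], symmetric])
  then show ?thesis
    using cone_lessI[OF cone_mul[OF q(1) p(1) q(2) p(2)] G_mul[OF q(2) p(2)] g] by simp
qed

lemma cone_less_total:
  assumes g: "g \<in> Hom G x z" and h: "h \<in> Hom G y z" and "g \<noteq> h"
  shows "cone_less g h \<or> cone_less h g"
proof -
  obtain g' where g': "g' \<in> Hom G z x" "g \<cdot> g' = ident C x" "g' \<cdot> g = ident C z"
    using G_inverse[OF g] .
  obtain h' where h': "h' \<in> Hom G z y" "h \<cdot> h' = ident C y" "h' \<cdot> h = ident C z"
    using G_inverse[OF h] .
  note assoc = mul_assoc[OF G_Hom G_Hom G_Hom]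
  have q: "h \<cdot> g' \<in> Hom G y x" and r: "g \<cdot> h' \<in> Hom G x y" using G_mul g g' h h' by blast+
  have qg: "h \<cdot> g' \<cdot> g = h"
    using assoc[OF h g'(1) g] g'(3) mul_ident_right[OF G_Hom[OF h]] by simp
  have rh: "g \<cdot> h' \<cdot> h = g"
    using assoc[OF g h'(1) h] h'(3) mul_ident_right[OF G_Hom[OF g]] by simp
  have "h \<cdot> g' \<cdot> (g \<cdot> h') = ident C y" "g \<cdot> h' \<cdot> (h \<cdot> g') = ident C x"
    using assoc[OF q g h'(1)] assoc[OF r h g'(1)] qg rh g' h' by simp_all
  \<comment> \<open>Otherwise \<open>h \<cdot> g' \<cdot> g = h\<close> would give
    \<open>g = h\<close>. Hence \<open>cone_total\<close> makes \<open>h \<cdot> g'\<close> or its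
    inverse \<open>g \<cdot> h'\<close> positive.\<close>
  moreover have "h \<cdot> g' \<noteq> ident C y"
  proof
    assume e: "h \<cdot> g' = ident C y"
    have "y \<in> Obj C" using Hom_Obj[OF G_Hom[OF h]] by blast
    from ident_in_Hom[OF this] e G_Hom[OF q] have "x = y" by (simp add: Hom_def)
    with e qg mul_ident_left[OF G_Hom[OF g]] \<open>g \<noteq> h\<close> show False by simp
  qed
  ultimately have "h \<cdot> g' \<in> P \<or> g \<cdot> h' \<in> P" using cone_total[OF q r] by blast
  then show ?thesis using cone_lessI[OF _ q g] cone_lessI[OF _ r h] qg rh by auto
qed

lemma cone_less_mul:
  assumes "cone_less g h" "g \<in> Hom G x y" "k \<in> Hom G y z"
  shows "cone_less (g \<cdot> k) (h \<cdot> k)"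
proof -
  obtain p w where p: "p \<in> P" "p \<in> Hom G w x" "h = p \<cdot> g" using cone_lessE[OF assms(1,2)] .
  show ?thesis
    using cone_lessI[OF p(1,2) G_mul[OF assms(2,3)]] p(3)
      mul_assoc[OF G_Hom[OF p(2)] G_Hom[OF assms(2)] G_Hom[OF assms(3)]] by simp
qed

text \<open>For \<open>h = p \<cdot> g\<close> the cocycle rule writes the new \<open>G\<close>-part
  of \<open>h\<close> as an exchanged \<open>p\<close> times that of \<open>g\<close>, and
  \<open>cone_exchange\<close> keeps the first factor positive.\<close>

lemma cone_less_exchange:
  assumes "cone_less g h" and g: "g \<in> Hom G x y" and f: "f \<in> Hom F y z"
  shows "cone_less (G_part (g \<cdot> f)) (G_part (h \<cdot> f))"
proof -
  obtain p w where p: "p \<in> P" "p \<in> Hom G w x" "h = p \<cdot> g" using cone_lessE[OF assms(1,2)] .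
  obtain u where u: "F_part (g \<cdot> f) \<in> Hom F x u" "G_part (g \<cdot> f) \<in> Hom G u z"
    using factorize[OF mul_in_Hom[OF G_Hom[OF g] F_Hom[OF f]]] by metis
  obtain v where "G_part (p \<cdot> F_part (g \<cdot> f)) \<in> Hom G v u"
    using factorize[OF mul_in_Hom[OF G_Hom[OF p(2)] F_Hom[OF u(1)]]] by metis
  then show ?thesis
    unfolding p(3) G_part_exchange[OF p(2) g f]
    using cone_lessI[OF cone_exchange[OF p(1,2) u(1)] _ u(2)] by blast
qed

text \<open>The \<open>F\<close>-parts are consulted only when the \<open>G\<close>-parts agree;
  otherwise their sources may differ and \<open>r\<close> says nothing about them.\<close>

definition lex_less :: "('b \<Rightarrow> 'b \<Rightarrow> bool) \<Rightarrow> 'b \<Rightarrow> 'b \<Rightarrow> bool" where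
  "lex_less r a b \<longleftrightarrow> cone_less (G_part a) (G_part b) \<or>
     G_part a = G_part b \<and> r (F_part a) (F_part b)"

lemma right_invariant_lex_less:
  assumes x: "x \<in> Obj C" and r: "right_invariant_order F x r"
  shows "right_invariant_order C x (lex_less r)"
proof -
  have "x \<in> Obj F" using x unfolding wide_Obj[OF wide_F] .
  note F = right_ore_F this r
  show ?thesis
    unfolding right_invariant_order_def
  proof (intro conjI allI ballI impI)
    fix z
    show "irreflp_on (Hom C x z) (lex_less r)"
    proof (rule irreflp_onI)
      fix a assume a: "a \<in> Hom C x z"
      then obtain y where "F_part a \<in> Hom F x y" "G_part a \<in> Hom G y z" by (rule factorize)
      then show "\<not> lex_less r a a"
        unfolding lex_less_def using cone_less_irrefl right_invariant_irrefl[OF F] by blast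
    qed
    show "transp_on (Hom C x z) (lex_less r)"
    proof (rule transp_onI)
      fix a b c
      assume h: "a \<in> Hom C x z" "b \<in> Hom C x z" "c \<in> Hom C x z"
        and ab: "lex_less r a b" and bc: "lex_less r b c"
      obtain y where y: "F_part a \<in> Hom F x y" "G_part a \<in> Hom G y z" using factorize[OF h(1)] .
      show "lex_less r a c"
      proof (cases "G_part a = G_part b \<and> G_part b = G_part c")
        case True
        then have "F_part b \<in> Hom F x y" "F_part c \<in> Hom F x y"
          using G_part_eq_F_part_Hom[of a x z b] G_part_eq_F_part_Hom[of a x z c] h y(1)
          by (auto simp: Hom_def)
        with True y show ?thesis
          using ab bc right_invariant_trans[OF F y(1)] cone_less_irrefl unfolding lex_less_def by metis
      next
        case False
        then show ?thesis
          using ab bc cone_less_trans[OF y(2)] unfolding lex_less_def by metis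
      qed
    qed
    show "totalp_on (Hom C x z) (lex_less r)"
    proof (rule totalp_onI)
      fix a b assume h: "a \<in> Hom C x z" "b \<in> Hom C x z" "a \<noteq> b"
      obtain y where y: "F_part a \<in> Hom F x y" "G_part a \<in> Hom G y z" "a = F_part a \<cdot> G_part a"
        using factorize[OF h(1)] .
      obtain y' where y': "F_part b \<in> Hom F x y'" "G_part b \<in> Hom G y' z" "b = F_part b \<cdot> G_part b"
        using factorize[OF h(2)] .
      show "lex_less r a b \<or> lex_less r b a"
      proof (cases "G_part a = G_part b")
        case True
        then have "F_part a \<noteq> F_part b" "y = y'"
          using h(3) y y' by (metis, simp add: Hom_def)
        then show ?thesis unfolding lex_less_def using right_invariant_total[OF F] True y(1) y'(1) by metis
      next
        case False
        then show ?thesis unfolding lex_less_def using cone_less_total[OF y(2) y'(2)] by blast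
      qed
    qed
  next
    fix z w a b k
    assume h: "a \<in> Hom C x z" "b \<in> Hom C x z" "k \<in> Hom C z w" and ab: "lex_less r a b"
    obtain y where a: "F_part a \<in> Hom F x y" "G_part a \<in> Hom G y z" "a = F_part a \<cdot> G_part a"
      using factorize[OF h(1)] .
    obtain y' where b: "F_part b \<in> Hom F x y'" "G_part b \<in> Hom G y' z" "b = F_part b \<cdot> G_part b"
      using factorize[OF h(2)] .
    obtain v where k: "F_part k \<in> Hom F z v" "G_part k \<in> Hom G v w" "k = F_part k \<cdot> G_part k"
      using factorize[OF h(3)] .
    obtain u where u: "F_part (G_part a \<cdot> F_part k) \<in> Hom F y u"
      "G_part (G_part a \<cdot> F_part k) \<in> Hom G u v"
      using factorize[OF mul_in_Hom[OF G_Hom[OF a(2)] F_Hom[OF k(1)]]] .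
    note ak = parts_mul_mul[OF a(1,2) k(1,2), folded a(3) k(3)]
    note bk = parts_mul_mul[OF b(1,2) k(1,2), folded b(3) k(3)]
    show "lex_less r (a \<cdot> k) (b \<cdot> k)"
    proof (cases "cone_less (G_part a) (G_part b)")
      case True
      from cone_less_mul[OF cone_less_exchange[OF this a(2) k(1)] u(2) k(2)]
      show ?thesis unfolding lex_less_def ak bk ..
    next
      case False
      \<comment> \<open>With equal \<open>G\<close>-parts, both \<open>F\<close>-parts get
        multiplied by the same morphism, so invariance of \<open>r\<close> suffices.\<close>
      with ab have e: "G_part a = G_part b" and "r (F_part a) (F_part b)"
        unfolding lex_less_def by auto
      moreover have "F_part b \<in> Hom F x y"
        using a(2) b(1,2) e by (simp add: Hom_def)
      ultimately have "r (F_part a \<cdot> F_part (G_part a \<cdot> F_part k)) (F_part b \<cdot> F_part (G_part a \<cdot> F_part k))"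
        using right_invariant_mul[OF F a(1) _ u(1)] wide_mul[OF wide_F _ u(1)] a(1) by metis
      then show ?thesis unfolding lex_less_def ak bk using e by simp
    qed
  qed
qed

end

text \<open>The equation \<open>w \<cdot> p = q \<cdot> w\<close> says that \<open>q\<close> is the
  conjugate \<open>w p w^-1\<close>, so \<open>cone_conj\<close> is conjugation invariance of
  \<open>P\<close> within vertex groups.\<close>

locale pure_positive_cone = exchange_positive_cone +
  assumes pure: "pure_product C F G"
    and cone_conj: "p \<in> P \<Longrightarrow> p \<in> Hom G x x \<Longrightarrow> w \<in> Hom G x x \<Longrightarrow> q \<in> Hom G x x \<Longrightarrow>
      w \<cdot> p = q \<cdot> w \<Longrightarrow> q \<in> P"
begin

lemma G_Hom_discrete: "g \<in> Hom G x y \<Longrightarrow> x = y"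
proof (rule ccontr)
  assume g: "g \<in> Hom G x y" and "x \<noteq> y"
  moreover have "x \<in> Obj G" "y \<in> Obj G"
    using Hom_Obj[OF G_Hom[OF g]] unfolding wide_Obj[OF wide_G] by simp_all
  ultimately show False using pure unfolding pure_product_def discrete_groupoid_def by blast
qed

text \<open>As \<open>G\<close> is discrete, the middle object of the factorization is the source of
  \<open>a\<close>; hence all \<open>F\<close>-parts from one hom-set lie in one hom-set of
  \<open>F\<close>.\<close>

lemma pure_factorize:
  assumes "a \<in> Hom C x y"
  shows "F_part a \<in> Hom F x y" "G_part a \<in> Hom G y y" "F_part a \<cdot> G_part a = a"
proof -
  obtain z where "F_part a \<in> Hom F x z" "G_part a \<in> Hom G z y" "a = F_part a \<cdot> G_part a"
    using factorize[OF assms] .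
  moreover from this have "z = y" using G_Hom_discrete by blast
  ultimately show "F_part a \<in> Hom F x y" "G_part a \<in> Hom G y y" "F_part a \<cdot> G_part a = a"
    by simp_all
qed

lemma pure_exchange:
  assumes g: "g \<in> Hom G x x" and f: "f \<in> Hom F x y"
  shows "F_part (g \<cdot> f) = f"
proof -
  have "x \<in> Obj C" "f \<in> Arr F" "tgt F f = x" using Hom_Obj[OF G_Hom[OF g]] f by (auto simp: Hom_def)
  with pure g show ?thesis unfolding pure_product_def act_on_eq by blast
qed

lemma pure_G_part_exchange:
  assumes "g \<in> Hom G x x" "f \<in> Hom F x y"
  shows "G_part (g \<cdot> f) \<in> Hom G y y"
  using pure_factorize(2)[OF mul_in_Hom[OF G_Hom[OF assms(1)] F_Hom[OF assms(2)]]] .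

text \<open>By purity the exchange leaves \<open>F_part k\<close> unchanged, so taking
  \<open>F\<close>-parts is multiplicative, while the \<open>G\<close>-part is multiplicative up to
  a twist by \<open>F_part k\<close>.\<close>

lemma pure_parts_mul:
  assumes a: "a \<in> Hom C x y" and k: "k \<in> Hom C y z"
  shows "F_part (a \<cdot> k) = F_part a \<cdot> F_part k"
    and "G_part (a \<cdot> k) = G_part (G_part a \<cdot> F_part k) \<cdot> G_part k"
proof -
  note a' = pure_factorize[OF a] and k' = pure_factorize[OF k]
  from parts_mul_mul[OF a'(1,2) k'(1,2)] pure_exchange[OF a'(2) k'(1)]
  show "F_part (a \<cdot> k) = F_part a \<cdot> F_part k"
    "G_part (a \<cdot> k) = G_part (G_part a \<cdot> F_part k) \<cdot> G_part k"
    unfolding a'(3) k'(3) by simp_all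
qed

text \<open>Here \<open>k l\<inverse> = u\<inverse> p u\<close> is a conjugate of \<open>p\<close>, and \<open>q = (v u\<inverse>) p (v u\<inverse>)\<inverse>\<close>.\<close>

lemma cone_less_conj:
  assumes p: "p \<in> P" and G: "p \<in> Hom G y y" "u \<in> Hom G y y" "v \<in> Hom G y y" "k \<in> Hom G y y" "l \<in> Hom G y y"
    and eq: "u \<cdot> k = p \<cdot> u \<cdot> l"
  shows "cone_less (v \<cdot> l) (v \<cdot> k)"
proof -
  note assoc = mul_assoc[OF G_Hom G_Hom G_Hom]
  obtain u' where u': "u' \<in> Hom G y y" "u \<cdot> u' = ident C y" "u' \<cdot> u = ident C y"
    using G_inverse[OF G(2)] .
  obtain v' where v': "v' \<in> Hom G y y" "v \<cdot> v' = ident C y" "v' \<cdot> v = ident C y"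
    using G_inverse[OF G(3)] .
  define w w' where "w = v \<cdot> u'" and "w' = u \<cdot> v'"
  have w: "w \<in> Hom G y y" "w' \<in> Hom G y y" unfolding w_def w'_def using G_mul G u' v' by blast+
  have wu: "w \<cdot> u = v"
    unfolding w_def using assoc[OF G(3) u'(1) G(2)] u'(3) mul_ident_right[OF G_Hom[OF G(3)]] by simp
  have w'v: "w' \<cdot> v = u"
    unfolding w'_def using assoc[OF G(2) v'(1) G(3)] v'(3) mul_ident_right[OF G_Hom[OF G(2)]] by simp
  have "w' \<cdot> w = w' \<cdot> v \<cdot> u'" unfolding w_def by (rule assoc[OF w(2) G(3) u'(1), symmetric])
  then have w'w: "w' \<cdot> w = ident C y" using w'v u'(2) by simp
  define q where "q = w \<cdot> p \<cdot> w'"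
  have wp: "w \<cdot> p \<in> Hom G y y" by (rule G_mul[OF w(1) G(1)])
  have q: "q \<in> Hom G y y" unfolding q_def by (rule G_mul[OF wp w(2)])
  have "q \<cdot> w = w \<cdot> p"
    unfolding q_def using assoc[OF wp w(2,1)] w'w mul_ident_right[OF G_Hom[OF wp]] by simp
  then have "q \<in> P" using cone_conj[OF p G(1) w(1) q] by simp
  moreover have "q \<cdot> (v \<cdot> l) = v \<cdot> k"
  proof -
    have "q \<cdot> (v \<cdot> l) = q \<cdot> v \<cdot> l" by (rule assoc[OF q G(3,5), symmetric])
    also have "q \<cdot> v = w \<cdot> p \<cdot> u" unfolding q_def using assoc[OF wp w(2) G(3)] w'v by simp
    also have "w \<cdot> p \<cdot> u \<cdot> l = w \<cdot> (p \<cdot> u \<cdot> l)"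
      using assoc[OF w(1) G(1,2)] assoc[OF w(1) G_mul[OF G(1,2)] G(5)] by simp
    also have "\<dots> = w \<cdot> u \<cdot> k" using assoc[OF w(1) G(2,4)] eq by simp
    finally show ?thesis unfolding wu .
  qed
  ultimately show ?thesis using cone_lessI[OF _ q G_mul[OF G(3,5)]] by metis
qed

text \<open>Giving priority to the \<open>F\<close>-part is possible here because
  \<open>F\<close>-parts of morphisms with equal source and target are always comparable.\<close>

definition pure_lex_less :: "('b \<Rightarrow> 'b \<Rightarrow> bool) \<Rightarrow> 'b \<Rightarrow> 'b \<Rightarrow> bool" where
  "pure_lex_less r a b \<longleftrightarrow> r (F_part a) (F_part b) \<or>
     F_part a = F_part b \<and> cone_less (G_part a) (G_part b)"

context
  fixes x r
  assumes x: "x \<in> Obj C" and r: "right_invariant_order F x r"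
begin

lemma x_F: "x \<in> Obj F"
  using x unfolding wide_Obj[OF wide_F] .

lemmas F_irrefl = right_invariant_irrefl[OF right_ore_F x_F r]
  and F_trans = right_invariant_trans[OF right_ore_F x_F r]
  and F_total = right_invariant_total[OF right_ore_F x_F r]

lemma F_less_mul:
  "a \<in> Hom F x y \<Longrightarrow> b \<in> Hom F x y \<Longrightarrow> k \<in> Hom F y z \<Longrightarrow> r a b \<Longrightarrow> r (a \<cdot> k) (b \<cdot> k)"
  using right_invariant_mul[OF right_ore_F x_F r] wide_mul[OF wide_F] by metis

text \<open>Right multiplication by \<open>k\<close> multiplies \<open>F\<close>-parts by
  \<open>F_part k\<close> and sends \<open>G\<close>-parts through an exchange followed by a
  product; both operations preserve the respective order.\<close>

lemma right_invariant_pure_lex_less: "right_invariant_order C x (pure_lex_less r)"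
  unfolding right_invariant_order_def
proof (intro conjI allI ballI impI)
  fix z
  show "irreflp_on (Hom C x z) (pure_lex_less r)"
  proof (rule irreflp_onI)
    fix a assume "a \<in> Hom C x z"
    note a = pure_factorize[OF this]
    show "\<not> pure_lex_less r a a"
      unfolding pure_lex_less_def using cone_less_irrefl[OF a(2)] F_irrefl[OF a(1)] by simp
  qed
  show "transp_on (Hom C x z) (pure_lex_less r)"
  proof (rule transp_onI)
    fix a b c
    assume h: "a \<in> Hom C x z" "b \<in> Hom C x z" "c \<in> Hom C x z"
      and l: "pure_lex_less r a b" "pure_lex_less r b c"
    note p = h[THEN pure_factorize(1)] h[THEN pure_factorize(2)]
    show "pure_lex_less r a c"
      using l F_trans[OF p(1-3)] cone_less_trans[OF p(4)] unfolding pure_lex_less_def by metis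
  qed
  show "totalp_on (Hom C x z) (pure_lex_less r)"
  proof (rule totalp_onI)
    fix a b assume h: "a \<in> Hom C x z" "b \<in> Hom C x z" "a \<noteq> b"
    note p = h(1,2)[THEN pure_factorize(1)] h(1,2)[THEN pure_factorize(2)]
      h(1,2)[THEN pure_factorize(3)]
    show "pure_lex_less r a b \<or> pure_lex_less r b a"
      using F_total[OF p(1,2)] cone_less_total[OF p(3,4)] p(5,6) h(3)
      unfolding pure_lex_less_def by metis
  qed
next
  fix y z a b k
  assume h: "a \<in> Hom C x y" "b \<in> Hom C x y" and k: "k \<in> Hom C y z" and l: "pure_lex_less r a b"
  note a = pure_factorize[OF h(1)] and b = pure_factorize[OF h(2)] and k' = pure_factorize[OF k]
  have "r (F_part a) (F_part b) \<Longrightarrow> r (F_part a \<cdot> F_part k) (F_part b \<cdot> F_part k)"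
    by (rule F_less_mul[OF a(1) b(1) k'(1)])
  moreover have "cone_less (G_part a) (G_part b) \<Longrightarrow>
      cone_less (G_part (G_part a \<cdot> F_part k) \<cdot> G_part k) (G_part (G_part b \<cdot> F_part k) \<cdot> G_part k)"
    by (rule cone_less_mul[OF cone_less_exchange[OF _ a(2) k'(1)] pure_G_part_exchange[OF a(2) k'(1)] k'(2)])
  ultimately show "pure_lex_less r (a \<cdot> k) (b \<cdot> k)"
    using l unfolding pure_lex_less_def pure_parts_mul[OF h(1) k] pure_parts_mul[OF h(2) k] by auto
qed

text \<open>The equation \<open>a \<cdot> k = b \<cdot> l\<close> splits into its
  \<open>F\<close>-part and its \<open>G\<close>-part. If the \<open>F\<close>-parts of
  \<open>a\<close> and \<open>b\<close> differ, the hypothesis on \<open>r\<close> decides;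
  otherwise the comparison takes place in the vertex group of \<open>G\<close> at
  \<open>z\<close>.\<close>

lemma conjugation_invariant_pure_lex_less:
  assumes conj: "conjugation_invariant_order F x r"
  shows "conjugation_invariant_order C x (pure_lex_less r)"
  unfolding conjugation_invariant_order_def
proof (intro allI ballI impI)
  fix y z a b d k l
  assume h: "a \<in> Hom C x y" "b \<in> Hom C x y" "d \<in> Hom C x y"
    and k: "k \<in> Hom C y z" and l: "l \<in> Hom C y z"
    and ab: "pure_lex_less r a b" and eq: "a \<cdot> k = b \<cdot> l"
  note a = pure_factorize[OF h(1)] and b = pure_factorize[OF h(2)] and d = pure_factorize[OF h(3)]
    and k' = pure_factorize[OF k] and l' = pure_factorize[OF l]
  have eqF: "F_part a \<cdot> F_part k = F_part b \<cdot> F_part l"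
    using pure_parts_mul(1)[OF h(1) k] pure_parts_mul(1)[OF h(2) l] eq by simp
  have eqG: "G_part (G_part a \<cdot> F_part k) \<cdot> G_part k = G_part (G_part b \<cdot> F_part l) \<cdot> G_part l"
    using pure_parts_mul(2)[OF h(1) k] pure_parts_mul(2)[OF h(2) l] eq by simp
  show "pure_lex_less r (d \<cdot> l) (d \<cdot> k)"
  proof (cases "r (F_part a) (F_part b)")
    case True
    have "mul F (F_part a) (F_part k) = mul F (F_part b) (F_part l)"
      unfolding wide_mul[OF wide_F a(1) k'(1)] wide_mul[OF wide_F b(1) l'(1)] by (rule eqF)
    with True have "r (mul F (F_part d) (F_part l)) (mul F (F_part d) (F_part k))"
      using conj a(1) b(1) d(1) k'(1) l'(1) unfolding conjugation_invariant_order_def by blast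
    then have "r (F_part d \<cdot> F_part l) (F_part d \<cdot> F_part k)"
      unfolding wide_mul[OF wide_F d(1) k'(1)] wide_mul[OF wide_F d(1) l'(1)] .
    then show ?thesis
      unfolding pure_lex_less_def pure_parts_mul[OF h(3) k] pure_parts_mul[OF h(3) l] ..
  next
    case False
    with ab have e: "F_part a = F_part b" and less: "cone_less (G_part a) (G_part b)"
      unfolding pure_lex_less_def by auto
    have kl: "F_part k = F_part l"
      using ore_cancel_left[OF ore F_Hom[OF a(1)] F_Hom[OF k'(1)] F_Hom[OF l'(1)]] eqF e by simp
    let ?u = "G_part (G_part a \<cdot> F_part k)"
    have u: "?u \<in> Hom G z z" by (rule pure_G_part_exchange[OF a(2) k'(1)])
    \<comment> \<open>Here \<open>p\<close> is the positive quotient of the \<open>G\<close>-parts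
      of \<open>b\<close> and \<open>a\<close> after both are exchanged with
      \<open>F_part k\<close>.\<close>
    obtain p t where p: "p \<in> P" "p \<in> Hom G t z" "G_part (G_part b \<cdot> F_part k) = p \<cdot> ?u"
      using cone_lessE[OF cone_less_exchange[OF less a(2) k'(1)] u] .
    have "p \<in> Hom G z z" using p(2) G_Hom_discrete by blast
    moreover have "?u \<cdot> G_part k = p \<cdot> ?u \<cdot> G_part l" using eqG p(3) kl by simp
    ultimately have "cone_less (G_part (G_part d \<cdot> F_part k) \<cdot> G_part l) (G_part (G_part d \<cdot> F_part k) \<cdot> G_part k)"
      using cone_less_conj[OF p(1) _ u pure_G_part_exchange[OF d(2) k'(1)] k'(2) l'(2)] by blast
    then show ?thesis
      unfolding pure_lex_less_def pure_parts_mul[OF h(3) k] pure_parts_mul[OF h(3) l] kl by simp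
  qed
qed

end

end


section \<open>Positive cones of discrete orderings\<close>

text \<open>Inverses are unique, so the description in \<open>arr_inv\<close> evaluates to
  \<open>b\<close>.\<close>

lemma arr_inv_eq:
  assumes "category C" "inverse_pair C a b"
  shows "arr_inv C a = b"
  unfolding arr_inv_def
proof (rule the_equality)
  interpret category C by fact
  show "inverse_pair C a b" by fact
  fix c assume c: "inverse_pair C a c"
  have a: "a \<in> Hom C (tgt C a) (src C a)" and b: "b \<in> Hom C (src C a) (tgt C a)"
    and c': "c \<in> Hom C (src C a) (tgt C a)"
    using assms(2) c unfolding inverse_pair_def Hom_def by auto
  have "c = mul C (mul C b a) c"
    using assms(2) mul_ident_left[OF c'] unfolding inverse_pair_def by simp
  also have "\<dots> = mul C b (mul C a c)" by (rule mul_assoc[OF b a c'])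
  also have "\<dots> = b" using c mul_ident_right[OF b] unfolding inverse_pair_def by simp
  finally show "c = b" .
qed

text \<open>Testing positivity at the source of \<open>g\<close> gives one set for all components;
  \<open>discrete_cone_iff\<close> identifies it with the cone at that source.\<close>

definition discrete_positive ::
  "('o, 'm) category \<Rightarrow> ('k, 'd) category \<Rightarrow> ('o \<Rightarrow> 'k) \<Rightarrow> ('m \<Rightarrow> 'd) \<Rightarrow>
   ('k \<Rightarrow> 'd \<Rightarrow> 'd \<Rightarrow> bool) \<Rightarrow> 'm set" where
  "discrete_positive G D \<phi> \<Phi> prec =
     {g \<in> Arr G. prec (\<phi> (src G g)) (ident D (\<phi> (src G g))) (\<Phi> g)}"

section \<open>Transfer of positivity from the vertex groups of \<open>D\<close> along
  \<open>\<Phi>\<close>\<close>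

context ore_indirect_product
begin

text \<open>The component of \<open>y\<close> is defined through morphisms with target
  \<open>y\<close>, so the inverse of \<open>g\<close> is what places \<open>x\<close> in
  it.\<close>

lemma Hom_G_component:
  assumes g: "g \<in> Hom G x y"
  shows "g \<in> Arr (component G y)"
proof -
  obtain h where "h \<in> Hom G y x" using G_inverse[OF g] .
  moreover have "x \<in> Obj G" "y \<in> Obj G"
    using Hom_Obj[OF G_Hom[OF g]] unfolding wide_Obj[OF wide_G] by simp_all
  moreover from this have "ident C y \<in> Hom G y y"
    using wide_ident_in_Hom[OF wide_G] wide_Obj[OF wide_G] by simp
  ultimately show ?thesis using g unfolding component_def Let_def by (auto simp: Hom_def)
qed

context
  fixes D :: "('k, 'd) category" and \<phi> \<Phi> prec
  assumes ordering: "discrete_left_ordering G D \<phi> \<Phi> prec"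
begin

lemma groupoid_D: "groupoid D"
  using ordering unfolding discrete_left_ordering_def discrete_groupoid_def by blast

lemma object_Obj: "x \<in> Obj C \<Longrightarrow> \<phi> x \<in> Obj D"
  using ordering unfolding discrete_left_ordering_def is_functor_def wide_Obj[OF wide_G] by blast

lemma vertex_group_group: "x \<in> Obj C \<Longrightarrow> group (vertex_group D (\<phi> x))"
  by (rule groupoid.group_vertex_group[OF groupoid_D object_Obj])

lemma vertex_group_ordering:
  "x \<in> Obj C \<Longrightarrow> left_ordering (vertex_group D (\<phi> x)) (prec (\<phi> x))"
  using ordering object_Obj unfolding discrete_left_ordering_def by blast

lemma object_eq: "g \<in> Hom G x y \<Longrightarrow> \<phi> x = \<phi> y"
  using ordering Hom_Obj[OF G_Hom, of g x y]
  unfolding discrete_left_ordering_def wide_Obj[OF wide_G] by blast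

lemma functor_carrier: "g \<in> Hom G x y \<Longrightarrow> \<Phi> g \<in> carrier (vertex_group D (\<phi> y))"
proof -
  assume g: "g \<in> Hom G x y"
  then have "\<Phi> g \<in> Hom D (\<phi> x) (\<phi> y)"
    using ordering Hom_Obj[OF G_Hom, of g x y]
    unfolding discrete_left_ordering_def is_functor_def wide_Obj[OF wide_G] by blast
  with object_eq[OF g] show ?thesis by (simp add: vertex_group_def)
qed

lemma functor_ident: "x \<in> Obj C \<Longrightarrow> \<Phi> (ident C x) = \<one>\<^bsub>vertex_group D (\<phi> x)\<^esub>"
proof -
  assume x: "x \<in> Obj C"
  have "\<forall>x\<in>Obj G. \<Phi> (ident G x) = ident D (\<phi> x)"
    using ordering unfolding discrete_left_ordering_def is_functor_def by blast
  moreover have "\<forall>x\<in>Obj G. ident G x = ident C x"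
    using wide_G unfolding wide_subcategory_def by blast
  ultimately show ?thesis using x by (simp add: wide_Obj[OF wide_G] vertex_group_def)
qed

lemma functor_mul:
  assumes g: "g \<in> Hom G x y" and h: "h \<in> Hom G y z"
  shows "\<Phi> (g \<cdot> h) = \<Phi> g \<otimes>\<^bsub>vertex_group D (\<phi> z)\<^esub> \<Phi> h"
proof -
  have "\<forall>a\<in>Arr G. \<forall>b\<in>Arr G. src G a = tgt G b \<longrightarrow> \<Phi> (mul G a b) = mul D (\<Phi> a) (\<Phi> b)"
    using ordering unfolding discrete_left_ordering_def is_functor_def by blast
  then show ?thesis
    using g h unfolding wide_mul[OF wide_G g h, symmetric] by (simp add: Hom_def vertex_group_def)
qed

lemma discrete_positive_iff:
  "g \<in> Hom G x y \<Longrightarrow> g \<in> discrete_positive G D \<phi> \<Phi> prec \<longleftrightarrow>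
    prec (\<phi> y) \<one>\<^bsub>vertex_group D (\<phi> y)\<^esub> (\<Phi> g)"
  unfolding discrete_positive_def vertex_group_def Hom_def by auto

lemma discrete_cone_iff:
  "g \<in> Hom G x y \<Longrightarrow> g \<in> discrete_cone G D \<phi> \<Phi> prec y \<longleftrightarrow> g \<in> discrete_positive G D \<phi> \<Phi> prec"
  using Hom_G_component[of g x y]
  unfolding discrete_positive_def discrete_cone_def Hom_def by auto

lemma discrete_positive_total:
  assumes g: "g \<in> Hom G x y" and h: "h \<in> Hom G y x"
    and gh: "g \<cdot> h = ident C x" "h \<cdot> g = ident C y"
  shows "g = ident C x \<or> g \<in> discrete_positive G D \<phi> \<Phi> prec \<or> h \<in> discrete_positive G D \<phi> \<Phi> prec"
proof -
  have y: "x \<in> Obj G" "y \<in> Obj G"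
    using Hom_Obj[OF G_Hom[OF g]] unfolding wide_Obj[OF wide_G] by simp_all
  then have id: "ident G x = ident C x" "ident G y = ident C y"
    using wide_G unfolding wide_subcategory_def by blast+
  have gA: "g \<in> Arr G" "tgt G g = x" "src G g = y" using g by (simp_all add: Hom_def)
  have pair: "inverse_pair G g h"
    unfolding inverse_pair_def gA using gA h gh id wide_mul[OF wide_G g h] wide_mul[OF wide_G h g]
    by simp
  have inv: "arr_inv G g = h" by (rule arr_inv_eq[OF groupoid.axioms(1)[OF groupoid_G] pair])
  have "\<forall>x\<in>Obj G. \<forall>g\<in>Arr (component G x).
      g = ident G (tgt G g) \<or> g \<in> discrete_cone G D \<phi> \<Phi> prec x \<or>
      arr_inv G g \<in> discrete_cone G D \<phi> \<Phi> prec x"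
    using ordering unfolding discrete_left_ordering_def by blast
  with y(2) Hom_G_component[OF g]
  have "g = ident G (tgt G g) \<or> g \<in> discrete_cone G D \<phi> \<Phi> prec y \<or>
      arr_inv G g \<in> discrete_cone G D \<phi> \<Phi> prec y" by blast
  then have "g = ident C x \<or> g \<in> discrete_cone G D \<phi> \<Phi> prec y \<or> h \<in> discrete_cone G D \<phi> \<Phi> prec y"
    unfolding gA inv id .
  \<comment> \<open>The cone at \<open>y\<close> tests \<open>h\<close> at \<open>y\<close> although
    its source is \<open>x\<close>; \<open>\<phi>\<close> takes the same value at both
    objects.\<close>
  moreover have "h \<in> discrete_positive G D \<phi> \<Phi> prec" if "h \<in> discrete_cone G D \<phi> \<Phi> prec y"
    using that object_eq[OF g] unfolding discrete_positive_iff[OF h] discrete_cone_def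
    by (simp add: vertex_group_def)
  ultimately show ?thesis using discrete_cone_iff[OF g] by blast
qed

text \<open>Identities and products are handled in the ordered vertex groups of \<open>D\<close>,
  totality is the last clause of \<open>discrete_left_ordering\<close>, and exchange is
  compatibility, since \<open>act_exp\<close> is the \<open>G\<close>-part of a product.\<close>

lemma exchange_positive_cone_discrete:
  assumes compat: "compatible C F G (discrete_cone G D \<phi> \<Phi> prec)"
  shows "exchange_positive_cone C F G (discrete_positive G D \<phi> \<Phi> prec)"
proof unfold_locales
  fix p q :: 'm and x y z :: 'o
  let ?P = "discrete_positive G D \<phi> \<Phi> prec"
  show "p \<in> Arr G" if "p \<in> ?P" using that unfolding discrete_positive_def by blast
  show "ident C x \<notin> ?P" if x: "x \<in> Obj C"
  proof -
    have "ident C x \<in> Hom G x x" using wide_ident_in_Hom[OF wide_G x] .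
    from discrete_positive_iff[OF this] functor_ident[OF x] show ?thesis
      using group.left_ordering_irrefl[OF vertex_group_group[OF x] vertex_group_ordering[OF x]]
        monoid.one_closed[OF group.is_monoid[OF vertex_group_group[OF x]]] by simp
  qed
  show "p \<cdot> q \<in> ?P" if pq: "p \<in> ?P" "q \<in> ?P" and p: "p \<in> Hom G x y" and q: "q \<in> Hom G y z"
  proof -
    have z: "z \<in> Obj C" using Hom_Obj[OF G_Hom[OF q]] by blast
    show ?thesis
      using pq functor_carrier[OF p] functor_carrier[OF q]
        group.left_ordering_pos_mult[OF vertex_group_group[OF z] vertex_group_ordering[OF z]]
      unfolding discrete_positive_iff[OF p] discrete_positive_iff[OF q]
        discrete_positive_iff[OF G_mul[OF p q]] functor_mul[OF p q] object_eq[OF q] by blast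
  qed
  show "p = ident C x \<or> p \<in> ?P \<or> q \<in> ?P"
    if "p \<in> Hom G x y" "q \<in> Hom G y x" "p \<cdot> q = ident C x" "q \<cdot> p = ident C y"
    using that by (rule discrete_positive_total)
  show "G_part (p \<cdot> f) \<in> ?P" if pP: "p \<in> ?P" and p: "p \<in> Hom G x y" and f: "f \<in> Hom F y z" for f
  proof -
    have "y \<in> Obj C" "z \<in> Obj C" using Hom_Obj[OF F_Hom[OF f]] by simp_all
    moreover have "p \<in> Arr G" "src G p = y" using p by (simp_all add: Hom_def)
    ultimately have "G_part (p \<cdot> f) \<in> discrete_cone G D \<phi> \<Phi> prec z"
      using compat f pP discrete_cone_iff[OF p] unfolding compatible_def act_exp_eq by blast
    moreover obtain w where "G_part (p \<cdot> f) \<in> Hom G w z"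
      using factorize[OF mul_in_Hom[OF G_Hom[OF p] F_Hom[OF f]]] .
    ultimately show ?thesis using discrete_cone_iff by blast
  qed
qed

text \<open>The functor turns \<open>w \<cdot> p = q \<cdot> w\<close> into the statement that
  \<open>\<Phi> q\<close> is the conjugate of \<open>\<Phi> p\<close> by \<open>\<Phi> w\<close>,
  and bi-orderings preserve positivity under conjugation.\<close>

lemma discrete_positive_conj:
  assumes bi: "bi_ordering (vertex_group D (\<phi> x)) (prec (\<phi> x))"
    and pP: "p \<in> discrete_positive G D \<phi> \<Phi> prec" and p: "p \<in> Hom G x x" and w: "w \<in> Hom G x x"
    and q: "q \<in> Hom G x x" and eq: "w \<cdot> p = q \<cdot> w"
  shows "q \<in> discrete_positive G D \<phi> \<Phi> prec"
proof -
  have x: "x \<in> Obj C" using Hom_Obj[OF G_Hom[OF p]] by blast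
  interpret V: group "vertex_group D (\<phi> x)" by (rule vertex_group_group[OF x])
  note c = functor_carrier[OF p] functor_carrier[OF w] functor_carrier[OF q]
  have "\<Phi> w \<otimes>\<^bsub>vertex_group D (\<phi> x)\<^esub> \<Phi> p = \<Phi> q \<otimes>\<^bsub>vertex_group D (\<phi> x)\<^esub> \<Phi> w"
    using functor_mul[OF w p] functor_mul[OF q w] eq by simp
  then have "\<Phi> w \<otimes>\<^bsub>vertex_group D (\<phi> x)\<^esub> \<Phi> p \<otimes>\<^bsub>vertex_group D (\<phi> x)\<^esub>
      inv\<^bsub>vertex_group D (\<phi> x)\<^esub> \<Phi> w = \<Phi> q"
    using c V.inv_solve_right'[of "\<Phi> q" "\<Phi> w \<otimes>\<^bsub>vertex_group D (\<phi> x)\<^esub> \<Phi> p" "\<Phi> w"]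
    by (metis V.m_closed)
  then show ?thesis
    using V.bi_ordering_pos_conj[OF bi c(2,1)] pP
    unfolding discrete_positive_iff[OF p] discrete_positive_iff[OF q] by simp
qed

end

end

theorem theorem1p5:
  fixes C F G :: "('o, 'm) category" and \<epsilon> :: 'o
  assumes "indirect_product C F G" and "right_ore C" and "groupoid G" and "\<epsilon> \<in> Obj C"
  shows
    "(left_orderable (fundamental_group F \<epsilon>) \<and>
        (\<exists>(D :: ('k, 'd) category) \<phi> \<Phi> prec. discrete_left_ordering G D \<phi> \<Phi> prec \<and>
           compatible C F G (discrete_cone G D \<phi> \<Phi> prec))
      \<longrightarrow> left_orderable (fundamental_group C \<epsilon>)) \<and>
     (pure_product C F G \<and> bi_orderable (fundamental_group F \<epsilon>) \<and>
        (\<exists>(D :: ('k, 'd) category) \<phi> \<Phi> prec. discrete_bi_ordering G D \<phi> \<Phi> prec \<and>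
           compatible C F G (discrete_cone G D \<phi> \<Phi> prec))
      \<longrightarrow> bi_orderable (fundamental_group C \<epsilon>))"
proof -
  interpret ore_indirect_product C F G by (intro ore_indirect_product.intro assms(1-3))
  have \<epsilon>: "\<epsilon> \<in> Obj F" using assms(4) unfolding wide_Obj[OF wide_F] .
  show ?thesis
  proof (intro conjI impI; elim conjE exE)
    fix D :: "('k, 'd) category" and \<phi> \<Phi> prec
    assume "left_orderable (fundamental_group F \<epsilon>)"
      and d: "discrete_left_ordering G D \<phi> \<Phi> prec"
        "compatible C F G (discrete_cone G D \<phi> \<Phi> prec)"
    \<comment> \<open>The criterion by orders on hom-sets is applicable to \<open>F\<close> because
      \<open>F\<close> is itself right-Ore.\<close>
    then obtain r where "right_invariant_order F \<epsilon> r"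
      using left_orderable_fundamental_group_iff[OF right_ore_F \<epsilon>] by blast
    from exchange_positive_cone.right_invariant_lex_less[OF
        exchange_positive_cone_discrete[OF d] assms(4) this]
    show "left_orderable (fundamental_group C \<epsilon>)"
      using left_orderable_fundamental_group_iff[OF ore assms(4)] by blast
  next
    fix D :: "('k, 'd) category" and \<phi> \<Phi> prec
    assume pure: "pure_product C F G" and "bi_orderable (fundamental_group F \<epsilon>)"
      and "discrete_bi_ordering G D \<phi> \<Phi> prec"
      and compat: "compatible C F G (discrete_cone G D \<phi> \<Phi> prec)"
    then have d: "discrete_left_ordering G D \<phi> \<Phi> prec"
      and bi: "\<forall>k\<in>Obj D. bi_ordering (vertex_group D k) (prec k)"
      unfolding discrete_bi_ordering_def by blast+
    obtain r where r: "right_invariant_order F \<epsilon> r" "conjugation_invariant_order F \<epsilon> r"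
      using bi_orderable_fundamental_group_iff[OF right_ore_F \<epsilon>]
        \<open>bi_orderable (fundamental_group F \<epsilon>)\<close> by blast
    interpret E: exchange_positive_cone C F G "discrete_positive G D \<phi> \<Phi> prec"
      by (rule exchange_positive_cone_discrete[OF d compat])
    interpret E: pure_positive_cone C F G "discrete_positive G D \<phi> \<Phi> prec"
    proof unfold_locales
      show "pure_product C F G" by (rule pure)
      fix p w q x
      assume p: "p \<in> Hom G x x"
        and *: "p \<in> discrete_positive G D \<phi> \<Phi> prec" "w \<in> Hom G x x" "q \<in> Hom G x x" "w \<cdot> p = q \<cdot> w"
      have "\<phi> x \<in> Obj D" using object_Obj[OF d] Hom_Obj[OF G_Hom[OF p]] by blast
      with bi show "q \<in> discrete_positive G D \<phi> \<Phi> prec"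
        using discrete_positive_conj[OF d _ *(1) p *(2-4)] by blast
    qed
    show "bi_orderable (fundamental_group C \<epsilon>)"
      using bi_orderable_fundamental_group_iff[OF ore assms(4)]
        E.right_invariant_pure_lex_less[OF assms(4) r(1)]
        E.conjugation_invariant_pure_lex_less[OF assms(4) r] by blast
  qed
qed

end
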